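(* For all positive integers $d\le n$ we have \begin{align*} A_d(2n,d)=&\sum_{j=0}^{\lfloor(d-1)/2 \rfloor}\frac{(-1)^j4^{j-n-d+1}}{(2j+1)!} \binom{2d-2j-1}{d} \zeta(2n-2j)\pi^{2j} \\ &+\sum_{c=1}^d \sum_{j=0}^{\lfloor(c-1)/2 \rfloor}\sum_{k=0}^{\lfloor(d-c)/2 \rfloor} \frac{(-1)^{c+j+k} (1-4^{j+k-n})}{c\, (2j)!\,(2k)!\,4^{d-1}} \binom{2c-2j-2}{c-1} \binom{2d-2c-2k}{d-c}\, z_{n,j,k} \\ &+\sum_{c=1}^d \sum_{j=1}^{\lfloor c/2 \rfloor} \sum_{k=0}^{\lfloor(d-c-1)/2 \rfloor} \frac{(-1)^{c+j+k} 4^{j+k-n-d+1}}{c\, (2j-1)!\,(2k+1)!} \binom{2c-2j-1}{c-1} \binom{2d-2c-2k-1}{d-c}\, z_{n,j,k}, \end{align*} where $z_{n,j,k}=\zeta(2n-2j-2k)\,\pi^{2j+2k}$.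
   Context: For positive integers $s_1,\dots,s_d$ and signs $\varepsilon_1,\dots,\varepsilon_d\in\{1,-1\}$ with $(s_1,\varepsilon_1)\ne(1,1)$, the (alternating) Euler sum is $$\zeta(s_1,\dots,s_d;\varepsilon_1,\dots,\varepsilon_d)=\sum_{n_1>\cdots>n_d\ge 1}\frac{\varepsilon_1^{n_1}\cdots \varepsilon_d^{n_d}}{ n_1^{s_1}\cdots n_d^{s_d}}.$$ For integers $0\le\alpha\le d\le n$, $$A_\alpha(2n,d)=\sum \zeta(2j_1,\dots,2j_d;\varepsilon_1,\dots,\varepsilon_d),$$ where the sum is over all positive integers $j_1,\dots,j_d$ with $j_1+\cdots+j_d=n$ and all $(\varepsilon_1,\dots,\varepsilon_d)\in\{1,-1\}^d$ with exactly $\alpha$ of the $\varepsilon_\ell$ equal to $-1$. Thus $A_d(2n,d)$ is the sum with all $\varepsilon_\ell=-1$. Also $\zeta(m)$ is the Riemann zeta value. Empty sums are $0$ (in particular a sum whose upper limit is smaller than its lower limit). *)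

theory Defs
  imports "HOL-Analysis.Analysis"
begin

definition decreasing_tuples :: "nat \<Rightarrow> nat \<Rightarrow> nat list set" where
  "decreasing_tuples d N = {ns. length ns = d \<and> sorted_wrt (>) ns \<and> set ns \<subseteq> {1..N}}"

(* The series is only conditionally convergent when the first argument is 1 with sign -1, so it is
   read as the limit of the partial sums over N >= n_1 > ... > n_d >= 1. The value is meaningful
   for lists of equal length, with positive entries in s, signs in eps, and
   (s_1, eps_1) different from (1, 1). *)
definition euler_sum :: "nat list \<Rightarrow> int list \<Rightarrow> real" where
  "euler_sum s eps =
     lim (\<lambda>N. \<Sum>ns\<in>decreasing_tuples (length s) N.
            \<Prod>i<length s. real_of_int (eps ! i) ^ (ns ! i) / real (ns ! i) ^ (s ! i))"

(* euler_A alpha m d is A_alpha(m, d), where m = 2n is the total weight. *)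
definition euler_A :: "nat \<Rightarrow> nat \<Rightarrow> nat \<Rightarrow> real" where
  "euler_A \<alpha> m d =
     (\<Sum>(js, eps) \<in> {(js, eps). length js = d \<and> (\<forall>j\<in>set js. j > 0) \<and> 2 * sum_list js = m \<and>
                        length eps = d \<and> set eps \<subseteq> {1, -1} \<and> count_list eps (-1) = \<alpha>}.
        euler_sum (map (\<lambda>j. 2 * j) js) eps)"

(* Riemann zeta value at an integer m >= 2. *)
definition zeta :: "nat \<Rightarrow> real" where
  "zeta m = (\<Sum>k. 1 / real (Suc k) ^ m)"

end

theory Submission
  imports Defs "HOL-Computational_Algebra.Formal_Laurent_Series"
begin

text \<open>
  Put \<open>q\<^sub>m = (2 / (\<pi> m))\<^sup>2\<close> and let \<open>t = \<theta>\<^sup>2\<close>. Choosing for every \<open>m\<close> either nothing or one pair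
  \<open>(n\<^sub>i, j\<^sub>i)\<close> with \<open>n\<^sub>i = m\<close> shows that the numbers \<open>A\<^sub>d(2n, d)\<close>, rescaled by \<open>(4 / \<pi>\<^sup>2)\<^sup>n\<close>, are
  the coefficients of \<open>y\<^sup>d t\<^sup>n\<close> in the infinite product over \<open>m \<ge> 1\<close> of
  \<open>1 + (-1)\<^sup>m y (q\<^sub>m t + q\<^sub>m\<^sup>2 t\<^sup>2 + \<dots>) = (1 - q\<^sub>m t (1 - (-1)\<^sup>m y)) / (1 - q\<^sub>m t)\<close>.
  By Euler's products for the sine and the cosine, the even \<open>m\<close> contribute
  \<open>sin (\<theta> \<surd>(1 - y)) / (\<theta> \<surd>(1 - y))\<close> to the numerator, the odd \<open>m\<close> contribute \<open>cos (\<theta> \<surd>(1 + y))\<close>, and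
  the denominator is \<open>sin (2 \<theta>) / (2 \<theta>) = sin \<theta> cos \<theta> / \<theta>\<close> (lemma \<open>euler_A_fps_product\<close>).

  The coefficient of \<open>y\<^sup>c\<close> in either factor of the numerator is, like a spherical Bessel function and up to a power of \<open>\<theta>\<close>, a
  polynomial times \<open>sin \<theta>\<close> plus a polynomial times \<open>cos \<theta>\<close> (lemma \<open>dilate_sinc_sqrt_nth\<close>). The coefficient of
  \<open>y\<^sup>d\<close> in the numerator is therefore a sum over \<open>c\<close>, where \<open>c\<close> is the exponent of \<open>y\<close> taken from the
  cosine factor, of polynomials times \<open>sin\<^sup>2 \<theta>\<close>, \<open>sin \<theta> cos \<theta>\<close> and \<open>cos\<^sup>2 \<theta>\<close>. Division by
  \<open>sin \<theta> cos \<theta>\<close> turns these into \<open>tan \<theta>\<close>, \<open>1\<close> and \<open>cot \<theta>\<close>. The expansions of \<open>\<theta> cot \<theta>\<close> and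
  \<open>\<theta> tan \<theta>\<close> have the coefficients \<open>\<zeta>(2r) / \<pi>\<^sup>2\<^sup>r\<close> and \<open>(4\<^sup>r - 1) \<zeta>(2r) / \<pi>\<^sup>2\<^sup>r\<close> up to constants,
  while the purely polynomial parts have too small a degree to reach \<open>t\<^sup>n\<close> when \<open>n \<ge> d\<close>. The summand
  \<open>c = 0\<close> gives the single sum of the formula (only a cotangent term survives), and the summands
  \<open>c \<ge> 1\<close> give the tangent terms and the cotangent terms of the two triple sums.

  The argument takes place among formal power series in \<open>t\<close> with real coefficients, and finite products
  converge to infinite ones coefficient by coefficient. Analysis enters only through Euler's sine
  product, which is transferred from functions to coefficients in lemma \<open>linear_prod_sine\<close>, and through
  the convergence of the sums defining the Euler sums and the zeta values.
\<close>

unbundle no vec_syntax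
unbundle fps_syntax

section \<open>Coefficientwise limits of formal power series\<close>

text \<open>
  Convergence in the usual metric on formal power series means that each coefficient is eventually
  constant, which is too strong here; the coefficients of the partial products converge as real numbers.
\<close>

definition coeffwise_lim :: "(nat \<Rightarrow> real fps) \<Rightarrow> real fps \<Rightarrow> bool" where
  "coeffwise_lim F L \<longleftrightarrow> (\<forall>n. (\<lambda>N. F N $ n) \<longlonglongrightarrow> L $ n)"

lemma coeffwise_lim_unique: "coeffwise_lim F L \<Longrightarrow> coeffwise_lim F M \<Longrightarrow> L = M"
  unfolding coeffwise_lim_def fps_eq_iff using LIMSEQ_unique by blast

lemma coeffwise_lim_mult:
  "coeffwise_lim F L \<Longrightarrow> coeffwise_lim G M \<Longrightarrow> coeffwise_lim (\<lambda>N. F N * G N) (L * M)"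
  unfolding coeffwise_lim_def fps_mult_nth by (auto intro!: tendsto_sum tendsto_mult)

lemma coeffwise_lim_sum:
  "(\<And>i. i \<in> A \<Longrightarrow> coeffwise_lim (F i) (L i)) \<Longrightarrow>
     coeffwise_lim (\<lambda>N. \<Sum>i\<in>A. F i N) (\<Sum>i\<in>A. L i)"
  unfolding coeffwise_lim_def fps_sum_nth by (auto intro!: tendsto_sum)

lemma coeffwise_lim_subseq:
  "coeffwise_lim F L \<Longrightarrow> strict_mono r \<Longrightarrow> coeffwise_lim (\<lambda>N. F (r N)) L"
  unfolding coeffwise_lim_def
  using LIMSEQ_subseq_LIMSEQ[unfolded o_def] by blast

text \<open>
  Long division: the coefficient of order \<open>n\<close> of the quotient is computed from finitely many coefficients
  of \<open>F\<close> and \<open>F * G\<close> and from earlier coefficients of \<open>G\<close>, so convergence passes to \<open>G\<close> by induction.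
\<close>

lemma coeffwise_lim_cancel_left:
  assumes F: "coeffwise_lim F L" and FG: "coeffwise_lim (\<lambda>N. F N * G N) R"
    and one: "\<And>N. F N $ 0 = 1"
  obtains M where "coeffwise_lim G M" and "L * M = R"
proof -
  have conv: "\<exists>l. (\<lambda>N. G N $ n) \<longlonglongrightarrow> l" for n
  proof (induction n rule: less_induct)
    case (less n)
    then obtain m where m: "\<And>i. i < n \<Longrightarrow> (\<lambda>N. G N $ i) \<longlonglongrightarrow> m i" by metis
    have "G N $ n = (F N * G N) $ n - (\<Sum>i=1..n. F N $ i * G N $ (n - i))" for N
      by (simp add: fps_mult_nth sum.atLeast_Suc_atMost one)
    moreover have "(\<lambda>N. (F N * G N) $ n - (\<Sum>i=1..n. F N $ i * G N $ (n - i)))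
        \<longlonglongrightarrow> R $ n - (\<Sum>i=1..n. L $ i * m (n - i))"
      using F FG unfolding coeffwise_lim_def
      by (intro tendsto_diff tendsto_sum tendsto_mult m) auto
    ultimately show ?case by auto
  qed
  then obtain M where M: "\<And>n. (\<lambda>N. G N $ n) \<longlonglongrightarrow> M n" by metis
  then have "coeffwise_lim G (Abs_fps M)" by (simp add: coeffwise_lim_def)
  with coeffwise_lim_mult[OF F this] coeffwise_lim_unique[OF FG] that show thesis by metis
qed

lemma summable_telescope_convergent:
  fixes f :: "nat \<Rightarrow> real"
  assumes "\<And>N. \<bar>f (Suc N) - f N\<bar> \<le> g N" and "summable g"
  shows "convergent f"
proof -
  have "summable (\<lambda>N. f (Suc N) - f N)"
    by (rule summable_comparison_test'[OF assms(2)]) (use assms(1) in auto)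
  then have "convergent (\<lambda>N. f N - f 0)"
    by (simp add: summable_iff_convergent sum_lessThan_telescope)
  from convergent_add[OF this convergent_const[of "f 0"]] show ?thesis by simp
qed

section \<open>Euler's sine product for coefficients\<close>

definition linear_prod :: "(nat \<Rightarrow> real) \<Rightarrow> nat \<Rightarrow> real fps" where
  "linear_prod v N = (\<Prod>k=1..N. 1 - fps_const (v k) * fps_X)"

lemma linear_prod_0 [simp]: "linear_prod v 0 = 1"
  by (simp add: linear_prod_def)

lemma linear_prod_Suc:
  "linear_prod v (Suc N) = linear_prod v N - fps_const (v (Suc N)) * (fps_X * linear_prod v N)"
  by (simp add: linear_prod_def algebra_simps)

lemma linear_prod_nth_0 [simp]: "linear_prod v N $ 0 = 1"
  by (induction N) (simp_all add: linear_prod_Suc)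

text \<open>
  The coefficients of the product with every sign made positive are nonnegative and sum to
  the value of that product at \<open>1\<close>; this dominates each coefficient uniformly in its order.
\<close>

lemma abs_linear_prod_nth_le:
  assumes "\<And>k. 0 \<le> v k"
  shows "\<bar>linear_prod v N $ n\<bar> \<le> (\<Prod>k=1..N. 1 + v k)"
proof (induction N arbitrary: n)
  case (Suc N)
  have P: "0 \<le> (\<Prod>k=1..N. 1 + v k)" by (intro prod_nonneg) (use assms in \<open>auto intro: add_nonneg_nonneg\<close>)
  have "\<bar>(fps_X * linear_prod v N) $ n\<bar> \<le> (\<Prod>k=1..N. 1 + v k)"
    using Suc P by simp
  then have "v (Suc N) * \<bar>(fps_X * linear_prod v N) $ n\<bar> \<le> v (Suc N) * (\<Prod>k=1..N. 1 + v k)"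
    using assms by (intro mult_left_mono)
  moreover have "\<bar>linear_prod v (Suc N) $ n\<bar>
      \<le> \<bar>linear_prod v N $ n\<bar> + v (Suc N) * \<bar>(fps_X * linear_prod v N) $ n\<bar>"
    using assms[of "Suc N"] unfolding linear_prod_Suc fps_sub_nth fps_mult_left_const_nth
    by (metis abs_mult abs_of_nonneg abs_triangle_ineq4)
  ultimately show ?case using Suc[of n] by (simp add: algebra_simps)
qed (simp add: fps_one_def)

lemma linear_prod_sums:
  assumes "norm (x::real) < 1"
  shows "(\<lambda>n. linear_prod v N $ n * x ^ n) sums (\<Prod>k=1..N. 1 - v k * x)"
proof (induction N)
  case 0
  have "(\<lambda>n. (1::real fps) $ n * x ^ n) = (\<lambda>n. if n = 0 then 1 else 0)"
    by auto
  then show ?case using sums_single[of 0 "\<lambda>_. 1::real"] by simp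
next
  case (Suc N)
  have *: "(\<lambda>n. (fps_X * linear_prod v N) $ Suc n * x ^ Suc n) sums (x * (\<Prod>k=1..N. 1 - v k * x))"
    using sums_mult[OF Suc, of x] by (simp add: mult_ac)
  have "(\<lambda>n. (fps_X * linear_prod v N) $ n * x ^ n) sums (x * (\<Prod>k=1..N. 1 - v k * x))"
    using sums_Suc[OF *] by simp
  from sums_diff[OF Suc sums_mult[OF this, of "v (Suc N)"]]
  show ?case by (simp only: linear_prod_Suc fps_sub_nth fps_mult_left_const_nth) (simp add: algebra_simps)
qed

lemma linear_prod_convergent:
  assumes nn: "\<And>k. 0 \<le> v k" and sv: "summable (\<lambda>k. v (Suc k))"
  obtains L M where "coeffwise_lim (linear_prod v) L" "\<And>N n. \<bar>linear_prod v N $ n\<bar> \<le> M"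
proof -
  let ?M = "exp (\<Sum>k. v (Suc k))"
  have bound: "\<bar>linear_prod v N $ n\<bar> \<le> ?M" for N n
  proof -
    have "(\<Prod>k=1..N. 1 + v k) \<le> (\<Prod>k=1..N. exp (v k))"
      using nn by (intro prod_mono) (auto intro: add_nonneg_nonneg)
    also have "\<dots> = exp (\<Sum>k<N. v (Suc k))"
      by (simp add: exp_sum prod.atLeast1_atMost_eq)
    also have "\<dots> \<le> ?M" using nn sv by (simp add: sum_le_suminf)
    finally show ?thesis using abs_linear_prod_nth_le[where v = v and N = N and n = n, OF nn] by linarith
  qed
  have "convergent (\<lambda>N. linear_prod v N $ n)" for n
  proof (rule summable_telescope_convergent)
    show "\<bar>linear_prod v (Suc N) $ n - linear_prod v N $ n\<bar> \<le> v (Suc N) * ?M" for N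
      using nn[of "Suc N"] bound[of N "n - 1"]
      by (auto simp: linear_prod_Suc abs_mult intro!: mult_left_mono)
  qed (use sv in \<open>simp add: summable_mult2\<close>)
  then obtain l where "\<And>n. (\<lambda>N. linear_prod v N $ n) \<longlonglongrightarrow> l n"
    unfolding convergent_def by metis
  then have "coeffwise_lim (linear_prod v) (Abs_fps l)" by (simp add: coeffwise_lim_def)
  then show thesis using bound that by blast
qed

lemma summable_shifted_inverse_squares: "summable (\<lambda>k. c / real (Suc k) ^ 2)"
proof -
  have "summable (\<lambda>k. inverse (real (Suc k) ^ 2))"
    using inverse_power_summable[of 2, where 'a=real] by (subst summable_Suc_iff) simp
  from summable_mult[OF this, of c] show ?thesis by (simp add: divide_inverse)
qed

text \<open>
  The lowest coefficient is the limit of the power series at \<open>0\<close>, hence zero; dividing by the variable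
  and repeating removes all of them.
\<close>

lemma powser_eq_zero_imp_coeffs_zero:
  fixes b :: "nat \<Rightarrow> real"
  assumes "0 < r" and "\<And>x. x \<noteq> 0 \<Longrightarrow> norm x < r \<Longrightarrow> (\<lambda>n. b n * x ^ n) sums 0"
  shows "b n = 0"
proof (induction n rule: less_induct)
  case (less n)
  have "(\<lambda>k. b (k + n) * x ^ k) sums 0" if x: "x \<noteq> 0" "norm x < r" for x
  proof -
    have "(\<lambda>k. b (k + n) * x ^ (k + n)) sums (0 - (\<Sum>i<n. b i * x ^ i))"
      by (rule sums_iff_shift[THEN iffD2]) (use assms(2)[OF x] in simp)
    also have "(\<Sum>i<n. b i * x ^ i) = 0" using less by simp
    finally have "(\<lambda>k. inverse (x ^ n) * (b (k + n) * x ^ (k + n))) sums (inverse (x ^ n) * (0 - 0))"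
      by (rule sums_mult)
    then show ?thesis using x by (simp add: power_add field_simps)
  qed
  from powser_limit_0_strong[OF assms(1), of "\<lambda>k. b (k + n)" "\<lambda>_. 0"] this
  have "((\<lambda>_::real. 0) \<longlongrightarrow> b n) (at (0::real))" by simp
  then show ?case by (simp add: tendsto_const_iff)
qed

text \<open>
  The coefficients of the partial products are bounded uniformly, so Tannery's theorem
  interchanges the limit over \<open>N\<close> with the power series in \<open>x\<^sup>2\<close> for \<open>\<bar>x\<bar> < 1\<close>. Euler's product evaluates the
  result as \<open>sin (a x) / (a x)\<close>, and equality of functions near \<open>0\<close> gives equality of series.
\<close>

lemma linear_prod_sine:
  assumes a: "a \<noteq> (0::real)"
  obtains L where "coeffwise_lim (linear_prod (\<lambda>k. (a / (pi * real k))\<^sup>2)) L"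
    and "fps_const a * (fps_X * (L oo fps_X ^ 2)) = fps_sin a"
proof -
  define v where "v = (\<lambda>k. (a / (pi * real k))\<^sup>2)"
  have "v (Suc k) = (a / pi)\<^sup>2 / real (Suc k) ^ 2" for k
    by (simp add: v_def power_divide power_mult_distrib)
  then have sv: "summable (\<lambda>k. v (Suc k))"
    using summable_shifted_inverse_squares by presburger
  obtain L M where L: "coeffwise_lim (linear_prod v) L"
    and M: "\<And>N n. \<bar>linear_prod v N $ n\<bar> \<le> M"
    using linear_prod_convergent[of v] sv by (auto simp: v_def)
  have main: "(\<lambda>n. L $ n * (x\<^sup>2) ^ n) sums (sin (a * x) / (a * x))" if x: "norm x < 1" "x \<noteq> 0" for x :: real
  proof -
    have x2: "norm (x\<^sup>2) < 1" using x by (simp add: power_less_one_iff abs_square_less_1)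
    have tan: "eventually (\<lambda>N. summable (\<lambda>k. norm (linear_prod v N $ k * (x\<^sup>2) ^ k))) sequentially \<and>
           summable (\<lambda>n. norm (L $ n * (x\<^sup>2) ^ n)) \<and>
           ((\<lambda>N. suminf (\<lambda>k. linear_prod v N $ k * (x\<^sup>2) ^ k)) \<longlonglongrightarrow> suminf (\<lambda>n. L $ n * (x\<^sup>2) ^ n))"
    proof (rule tannerys_theorem[where M = "\<lambda>k. M * (x\<^sup>2) ^ k"])
      show "(\<lambda>N. linear_prod v N $ k * (x\<^sup>2) ^ k) \<longlonglongrightarrow> L $ k * (x\<^sup>2) ^ k" for k
        using L unfolding coeffwise_lim_def by (intro tendsto_mult) auto
      show "eventually (\<lambda>(k, N). norm (linear_prod v N $ k * (x\<^sup>2) ^ k) \<le> M * (x\<^sup>2) ^ k)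
              (at_top \<times>\<^sub>F sequentially)"
        using M by (intro always_eventually) (auto simp: abs_mult intro!: mult_right_mono)
      show "summable (\<lambda>k. M * (x\<^sup>2) ^ k)" using x2 by (intro summable_mult summable_geometric) auto
    qed auto
    have "suminf (\<lambda>k. linear_prod v N $ k * (x\<^sup>2) ^ k) = (\<Prod>k=1..N. 1 - (a * x / pi)\<^sup>2 / (real k)\<^sup>2)" for N
      using sums_unique[OF linear_prod_sums[OF x2, of v N]]
      by (simp add: v_def power_divide power_mult_distrib mult_ac)
    with tan have "(\<lambda>N. (\<Prod>k=1..N. 1 - (a * x / pi)\<^sup>2 / (real k)\<^sup>2)) \<longlonglongrightarrow> suminf (\<lambda>n. L $ n * (x\<^sup>2) ^ n)"
      by simp
    moreover have "(\<lambda>N. (\<Prod>k=1..N. 1 - (a * x / pi)\<^sup>2 / (real k)\<^sup>2)) \<longlonglongrightarrow> sin (a * x) / (a * x)"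
      using sin_product_formula_real'[of "a * x / pi"] a x by simp
    ultimately have "suminf (\<lambda>n. L $ n * (x\<^sup>2) ^ n) = sin (a * x) / (a * x)"
      using LIMSEQ_unique by blast
    with tan show ?thesis using summable_norm_cancel by (metis summable_sums)
  qed
  define G where "G = fps_const a * (fps_X * (L oo fps_X ^ 2))"
  have G: "(\<lambda>n. G $ n * x ^ n) sums sin (a * x)" if x: "norm x < 1" "x \<noteq> 0" for x :: real
  proof -
    have "(\<lambda>n. (L oo fps_X ^ 2) $ n * x ^ n) sums (sin (a * x) / (a * x))"
    proof (subst sums_mono_reindex[of "\<lambda>n. 2 * n", symmetric])
      show "(\<lambda>n. (L oo fps_X ^ 2) $ (2 * n) * x ^ (2 * n)) sums (sin (a * x) / (a * x))"
        using main[OF x] by (simp add: fps_nth_compose_X_power power_mult)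
    qed (auto simp: strict_mono_def fps_nth_compose_X_power elim!: dvdE)
    from sums_mult[OF this, of "a * x"] have
      "(\<lambda>n. G $ Suc n * x ^ Suc n) sums sin (a * x)"
      using a x by (simp add: G_def mult_ac)
    from sums_Suc[OF this] show ?thesis by (simp add: G_def)
  qed
  have "(G - fps_sin a) $ n = 0" for n
  proof (rule powser_eq_zero_imp_coeffs_zero[of 1])
    fix x :: real assume x: "x \<noteq> 0" "norm x < 1"
    have "(\<lambda>n. fps_sin a $ n * x ^ n) sums sin (a * x)"
      using sums_eval_fps[of x "fps_sin a"] by simp
    from sums_diff[OF G[OF x(2,1)] this]
    show "(\<lambda>n. (G - fps_sin a) $ n * x ^ n) sums 0" by (simp add: algebra_simps)
  qed simp
  then have "G = fps_sin a" by (simp add: fps_eq_iff)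
  with L show thesis using that unfolding G_def v_def by blast
qed

text \<open>
  The series of \<open>sin (\<surd>t) / \<surd>t\<close> and of \<open>cos (\<surd>t)\<close>. Working in \<open>t = \<theta>\<^sup>2\<close> removes all parity
  conditions; the substitution \<open>t = \<theta>\<^sup>2\<close> occurs only in the comparison with the sine and cosine series.
\<close>

definition fps_sinc_sqrt :: "real fps" where
  "fps_sinc_sqrt = Abs_fps (\<lambda>n. (-1) ^ n / fact (2 * n + 1))"

definition fps_cos_sqrt :: "real fps" where
  "fps_cos_sqrt = Abs_fps (\<lambda>n. (-1) ^ n / fact (2 * n))"

lemma fps_compose_square_inject: "F oo fps_X ^ 2 = G oo fps_X ^ 2 \<longleftrightarrow> F = (G :: real fps)"
proof
  assume *: "F oo fps_X ^ 2 = G oo fps_X ^ 2"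
  have "F $ n = G $ n" for n
    using arg_cong[OF *, of "\<lambda>A. A $ (2 * n)"] by (simp add: fps_nth_compose_X_power)
  then show "F = G" by (simp add: fps_eq_iff)
qed simp

lemma fps_sin_conv_sinc_sqrt: "fps_sin 1 = fps_X * (fps_sinc_sqrt oo fps_X ^ 2)"
proof (rule fps_ext)
  fix n show "fps_sin 1 $ n = (fps_X * (fps_sinc_sqrt oo fps_X ^ 2)) $ n"
  proof (cases "even n")
    case True then show ?thesis
      by (cases "n = 0") (auto simp: fps_sin_def fps_nth_compose_X_power)
  next
    case False then obtain k where "n = 2 * k + 1" by (elim oddE)
    then show ?thesis by (simp add: fps_sin_def fps_nth_compose_X_power fps_sinc_sqrt_def ring_distribs)
  qed
qed

lemma fps_cos_conv_cos_sqrt: "fps_cos 1 = fps_cos_sqrt oo fps_X ^ 2"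
  by (rule fps_ext) (auto simp: fps_cos_def fps_nth_compose_X_power fps_cos_sqrt_def elim!: dvdE)

section \<open>The products over all, even and odd indices\<close>

text \<open>
  Reciprocals of the zeros in \<open>t = \<theta>\<^sup>2\<close> of \<open>sin (2 \<theta>) / (2 \<theta>)\<close>, \<open>sin \<theta> / \<theta>\<close> and \<open>cos \<theta>\<close>: the even
  multiples of \<open>\<pi> / 2\<close> are the zeros of the sine, the odd multiples those of the cosine.
\<close>

definition inv_root_all :: "nat \<Rightarrow> real" where "inv_root_all m = (2 / (pi * real m))\<^sup>2"
definition inv_root_even :: "nat \<Rightarrow> real" where "inv_root_even k = (1 / (pi * real k))\<^sup>2"
definition inv_root_odd :: "nat \<Rightarrow> real" where "inv_root_odd k = inv_root_all (2 * k - 1)"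

lemma inv_root_all_double: "inv_root_all (2 * k) = inv_root_even k"
  by (simp add: inv_root_all_def inv_root_even_def power_divide power_mult_distrib)

lemma prod_split_even_odd:
  "(\<Prod>m=1..2*M. f m) = (\<Prod>k=1..M. f (2 * k)) * (\<Prod>k=1..M. f (2 * k - 1 :: nat) :: 'a :: comm_monoid_mult)"
  by (induction M) (simp_all add: ac_simps)

lemma linear_prod_all_split:
  "linear_prod inv_root_all (2 * M) = linear_prod inv_root_even M * linear_prod inv_root_odd M"
  unfolding linear_prod_def inv_root_odd_def prod_split_even_odd inv_root_all_double ..

lemma
  shows linear_prod_inv_root_even: "coeffwise_lim (linear_prod inv_root_even) fps_sinc_sqrt"
    and linear_prod_inv_root_all: "coeffwise_lim (linear_prod inv_root_all) (fps_sinc_sqrt * fps_cos_sqrt)"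
    and linear_prod_inv_root_odd: "coeffwise_lim (linear_prod inv_root_odd) fps_cos_sqrt"
proof -
  obtain L where L: "coeffwise_lim (linear_prod inv_root_even) L"
    "fps_X * (L oo fps_X ^ 2) = fps_sin 1"
    using linear_prod_sine[of 1] unfolding inv_root_even_def[abs_def] by auto
  from L(2) have "L = fps_sinc_sqrt"
    by (simp add: fps_sin_conv_sinc_sqrt fps_compose_square_inject)
  with L(1) show even: "coeffwise_lim (linear_prod inv_root_even) fps_sinc_sqrt" by simp
  \<comment> \<open>Here the limit is \<open>sin (2 \<theta>) / (2 \<theta>)\<close>, which the double angle formula factors.\<close>
  obtain L where L: "coeffwise_lim (linear_prod inv_root_all) L"
    "fps_const 2 * (fps_X * (L oo fps_X ^ 2)) = fps_sin 2"
    using linear_prod_sine[of 2] unfolding inv_root_all_def[abs_def] by auto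
  have "fps_sin (2::real) = fps_const 2 * (fps_sin 1 * fps_cos 1)"
    using fps_sin_add[of "1::real" 1] by (simp add: numeral_fps_const[symmetric])
  also have "\<dots> = fps_const 2 * (fps_X * ((fps_sinc_sqrt * fps_cos_sqrt) oo fps_X ^ 2))"
    by (simp add: fps_sin_conv_sinc_sqrt fps_cos_conv_cos_sqrt fps_compose_mult_distrib mult_ac)
  finally have "L = fps_sinc_sqrt * fps_cos_sqrt"
    using L(2) by (simp add: fps_compose_square_inject)
  with L(1) show all: "coeffwise_lim (linear_prod inv_root_all) (fps_sinc_sqrt * fps_cos_sqrt)" by simp
  \<comment> \<open>The product over odd indices converges because it is the quotient of two convergent products.\<close>
  have "coeffwise_lim (\<lambda>M. linear_prod inv_root_even M * linear_prod inv_root_odd M) (fps_sinc_sqrt * fps_cos_sqrt)"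
    using coeffwise_lim_subseq[OF all, of "\<lambda>M. 2 * M"]
    by (simp add: linear_prod_all_split strict_mono_def)
  then obtain R where R: "coeffwise_lim (linear_prod inv_root_odd) R" "fps_sinc_sqrt * R = fps_sinc_sqrt * fps_cos_sqrt"
    by (rule coeffwise_lim_cancel_left[OF even _ linear_prod_nth_0])
  moreover have "fps_sinc_sqrt $ 0 \<noteq> 0" by (simp add: fps_sinc_sqrt_def)
  then have "fps_sinc_sqrt \<noteq> 0" by force
  ultimately show "coeffwise_lim (linear_prod inv_root_odd) fps_cos_sqrt" by simp
qed

section \<open>The generating function in two variables\<close>

text \<open>
  This is \<open>F(t (1 + s y))\<close>, as a series in \<open>y\<close> whose coefficients are series in \<open>t\<close>: the binomial theorem
  expands \<open>(1 + s y)\<^sup>n\<close>. It turns \<open>cos \<theta>\<close> into \<open>cos (\<theta> \<surd>(1 + y))\<close> for \<open>s = 1\<close>, and \<open>sin \<theta> / \<theta>\<close> into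
  \<open>sin (\<theta> \<surd>(1 - y)) / (\<theta> \<surd>(1 - y))\<close> for \<open>s = -1\<close>. Each coefficient is a multiple of a coefficient of
  \<open>F\<close>, so coefficientwise limits pass through it.
\<close>

definition dilate :: "real \<Rightarrow> real fps \<Rightarrow> real fps fps" where
  "dilate s F = Abs_fps (\<lambda>i. Abs_fps (\<lambda>n. s ^ i * real (n choose i) * F $ n))"

lemma dilate_nth [simp]: "dilate s F $ i $ n = s ^ i * real (n choose i) * F $ n"
  by (simp add: dilate_def)

text \<open>
  Substitution is multiplicative; on coefficients this is Vandermonde's convolution.
\<close>

lemma dilate_mult: "dilate s (F * G) = dilate s F * dilate s G"
proof (intro fps_ext)
  fix i n
  have "(dilate s F * dilate s G) $ i $ n =
    (\<Sum>a=0..i. \<Sum>b=0..n. (s ^ a * real (b choose a) * F $ b) *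
        (s ^ (i - a) * real ((n - b) choose (i - a)) * G $ (n - b)))"
    by (simp add: fps_mult_nth fps_sum_nth)
  also have "\<dots> = (\<Sum>b=0..n. \<Sum>a=0..i. (s ^ a * real (b choose a) * F $ b) *
        (s ^ (i - a) * real ((n - b) choose (i - a)) * G $ (n - b)))"
    by (rule sum.swap)
  also have "\<dots> = (\<Sum>b=0..n. s ^ i * real (n choose i) * (F $ b * G $ (n - b)))"
  proof (rule sum.cong)
    fix b assume b: "b \<in> {0..n}"
    have "(\<Sum>a=0..i. (s ^ a * real (b choose a) * F $ b) *
        (s ^ (i - a) * real ((n - b) choose (i - a)) * G $ (n - b)))
      = (\<Sum>a=0..i. s ^ i * (F $ b * G $ (n - b)) * (real (b choose a) * real ((n - b) choose (i - a))))"
    proof (rule sum.cong)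
      fix a assume "a \<in> {0..i}"
      then have "s ^ i = s ^ a * s ^ (i - a)" by (simp flip: power_add)
      then show "(s ^ a * real (b choose a) * F $ b) *
        (s ^ (i - a) * real ((n - b) choose (i - a)) * G $ (n - b)) =
        s ^ i * (F $ b * G $ (n - b)) * (real (b choose a) * real ((n - b) choose (i - a)))" by simp
    qed simp
    also have "\<dots> = s ^ i * (F $ b * G $ (n - b)) *
        real (\<Sum>a\<le>i. (b choose a) * ((n - b) choose (i - a)))"
      by (simp add: sum_distrib_left atLeast0AtMost)
    also have "\<dots> = s ^ i * real (n choose i) * (F $ b * G $ (n - b))"
      using b by (simp add: vandermonde)
    finally show "(\<Sum>a=0..i. (s ^ a * real (b choose a) * F $ b) *
        (s ^ (i - a) * real ((n - b) choose (i - a)) * G $ (n - b))) =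
        s ^ i * real (n choose i) * (F $ b * G $ (n - b))" .
  qed simp
  finally show "dilate s (F * G) $ i $ n = (dilate s F * dilate s G) $ i $ n"
    by (simp add: fps_mult_nth sum_distrib_left)
qed

lemma dilate_1 [simp]: "dilate s 1 = 1"
  by (intro fps_ext) (auto simp: fps_one_def)

lemma dilate_prod: "dilate s (\<Prod>x\<in>A. F x) = (\<Prod>x\<in>A. dilate s (F x))"
  by (induction A rule: infinite_finite_induct) (simp_all add: dilate_mult)

lemma dilate_linear:
  "dilate s (1 - fps_const q * fps_X) =
     1 - fps_const (fps_const q * fps_X) * (1 + fps_const (fps_const s) * fps_X)"
proof (intro fps_ext)
  fix i n
  show "dilate s (1 - fps_const q * fps_X) $ i $ n =
     (1 - fps_const (fps_const q * fps_X) * (1 + fps_const (fps_const s) * fps_X)) $ i $ n"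
    by (cases i; cases "i - 1"; cases n; cases "n - 1") (auto simp: fps_X_def)
qed

lemma dilate_linear_prod:
  "dilate s (linear_prod v N) = (\<Prod>k=1..N. 1 - fps_const (fps_const (v k) * fps_X) *
      (1 + fps_const (fps_const s) * fps_X))"
  by (simp add: linear_prod_def dilate_prod dilate_linear)

lemma coeffwise_lim_dilate:
  "coeffwise_lim F L \<Longrightarrow> coeffwise_lim (\<lambda>N. dilate s (F N) $ i) (dilate s L $ i)"
  unfolding coeffwise_lim_def by (auto intro!: tendsto_mult)

definition geo :: "real \<Rightarrow> real fps" where
  "geo q = Abs_fps (\<lambda>n. if n = 0 then 0 else q ^ n)"

lemma geo_mult: "(1 - fps_const q * fps_X) * geo q = fps_const q * fps_X"
proof -
  have "(geo q - fps_const q * (fps_X * geo q)) $ n = (fps_const q * fps_X) $ n" for n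
    by (cases n; cases "n - 1") (auto simp: geo_def)
  then show ?thesis by (simp add: fps_eq_iff algebra_simps)
qed

text \<open>
  A partial product of the generating function of the Euler sums: the outer variable \<open>y\<close> counts the depth,
  the inner variable \<open>t\<close> half of the weight.
\<close>

definition alt_prod :: "nat \<Rightarrow> real fps fps" where
  "alt_prod N = (\<Prod>m=1..N. 1 + fps_const (fps_const ((-1) ^ m) * geo (inv_root_all m)) * fps_X)"

text \<open>
  Each factor satisfies \<open>(1 - q t) (1 + e y (q t + q\<^sup>2 t\<^sup>2 + \<dots>)) = 1 - q t + e y q t\<close>, so clearing the
  denominators leaves linear factors in \<open>t\<close>.
\<close>

lemma fps_const_linear_prod_mult_alt_prod:
  "fps_const (linear_prod inv_root_all N) * alt_prod N =
     (\<Prod>m=1..N. 1 - fps_const (fps_const (inv_root_all m) * fps_X) *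
        (1 + fps_const (fps_const (- ((-1) ^ m))) * fps_X))"
proof -
  have fc: "fps_const (\<Prod>m\<in>A. f m) = (\<Prod>m\<in>A. fps_const (f m))" for A and f :: "nat \<Rightarrow> real fps"
    by (induction A rule: infinite_finite_induct) (simp_all flip: fps_const_mult)
  have factor: "fps_const (1 - fps_const q * fps_X) * (1 + fps_const (fps_const e * geo q) * fps_X) =
     1 - fps_const (fps_const q * fps_X) * (1 + fps_const (fps_const (- e)) * fps_X)"
    (is "?l = ?r") for q e :: real
  proof -
    have "?l = fps_const (1 - fps_const q * fps_X) +
        fps_const (fps_const e) * fps_const ((1 - fps_const q * fps_X) * geo q) * fps_X"
      by (simp add: algebra_simps flip: fps_const_mult)
    also have "\<dots> = ?r"
      unfolding geo_mult
      by (simp add: algebra_simps flip: fps_const_mult fps_const_sub fps_const_neg)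
    finally show ?thesis .
  qed
  then show ?thesis
    unfolding linear_prod_def alt_prod_def fc prod.distrib[symmetric] by (simp only: factor)
qed

lemma linear_prod_mult_alt_prod_nth:
  "linear_prod inv_root_all (2 * M) * alt_prod (2 * M) $ d =
     (\<Sum>c=0..d. dilate 1 (linear_prod inv_root_odd M) $ c * dilate (-1) (linear_prod inv_root_even M) $ (d - c))"
proof -
  have "(\<Prod>k=1..M. 1 - fps_const (fps_const (inv_root_all (2 * k - 1)) * fps_X) *
        (1 + fps_const (fps_const (- ((-1) ^ (2 * k - 1)))) * fps_X)) = dilate 1 (linear_prod inv_root_odd M)"
    unfolding dilate_linear_prod by (intro prod.cong) (auto simp: inv_root_odd_def)
  moreover have "(\<Prod>k=1..M. 1 - fps_const (fps_const (inv_root_all (2 * k)) * fps_X) *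
        (1 + fps_const (fps_const (- ((-1) ^ (2 * k)))) * fps_X)) = dilate (-1) (linear_prod inv_root_even M)"
    unfolding dilate_linear_prod by (simp add: inv_root_all_double)
  ultimately have "fps_const (linear_prod inv_root_all (2 * M)) * alt_prod (2 * M) =
    dilate 1 (linear_prod inv_root_odd M) * dilate (-1) (linear_prod inv_root_even M)"
    unfolding fps_const_linear_prod_mult_alt_prod prod_split_even_odd by (simp add: mult.commute)
  from arg_cong[OF this, of "\<lambda>F. F $ d"] show ?thesis by (simp add: fps_mult_nth[of "dilate 1 _"])
qed

section \<open>Euler sums as coefficients of the generating function\<close>

definition alt_trunc :: "nat \<Rightarrow> nat list \<Rightarrow> real" where
  "alt_trunc N js = (\<Sum>ns\<in>decreasing_tuples (length js) N.
     \<Prod>i<length js. (-1) ^ (ns ! i) / real (ns ! i) ^ (2 * js ! i))"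

lemma decreasing_tuples_0 [simp]: "decreasing_tuples 0 N = {[]}"
  by (auto simp: decreasing_tuples_def)

lemma decreasing_tuples_Suc_0 [simp]: "decreasing_tuples (Suc d) 0 = {}"
  by (auto simp: decreasing_tuples_def length_Suc_conv)

lemma finite_decreasing_tuples: "finite (decreasing_tuples d N)"
  by (rule finite_subset[OF _ finite_lists_length_eq[of "{1..N}" d]])
    (auto simp: decreasing_tuples_def)

lemma decreasing_tuples_Suc_Suc:
  "decreasing_tuples (Suc d) (Suc N) =
     decreasing_tuples (Suc d) N \<union> (#) (Suc N) ` decreasing_tuples d N"
proof (intro equalityI subsetI)
  fix ns assume "ns \<in> decreasing_tuples (Suc d) (Suc N)"
  then obtain m ms where "ns = m # ms" "length ms = d" "sorted_wrt (>) ms"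
    "\<forall>x\<in>set ms. x < m" "set ms \<subseteq> {1..Suc N}" "1 \<le> m" "m \<le> Suc N"
    by (auto simp: decreasing_tuples_def length_Suc_conv)
  then show "ns \<in> decreasing_tuples (Suc d) N \<union> (#) (Suc N) ` decreasing_tuples d N"
    by (cases "m = Suc N") (fastforce simp: decreasing_tuples_def)+
qed (auto simp: decreasing_tuples_def, force+)

lemma alt_trunc_Nil [simp]: "alt_trunc N [] = 1"
  by (simp add: alt_trunc_def)

lemma alt_trunc_0_Cons [simp]: "alt_trunc 0 (j # js) = 0"
  by (simp add: alt_trunc_def)

text \<open>
  The largest summation index is either at most \<open>N\<close> or equal to \<open>Suc N\<close>.
\<close>

lemma alt_trunc_Suc_Cons:
  "alt_trunc (Suc N) (j # js) =
     alt_trunc N (j # js) + (-1) ^ Suc N / real (Suc N) ^ (2 * j) * alt_trunc N js"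
proof -
  have disj: "decreasing_tuples (Suc d) N \<inter> (#) (Suc N) ` decreasing_tuples d N = {}" for d
    by (auto simp: decreasing_tuples_def)
  show ?thesis
    unfolding alt_trunc_def list.size decreasing_tuples_Suc_Suc add_0_right add_Suc_right
    by (subst sum.union_disjoint[OF _ _ disj])
      (auto simp: finite_decreasing_tuples sum.reindex inj_on_def prod.lessThan_Suc_shift
        sum_distrib_left simp del: power_Suc of_nat_Suc prod.lessThan_Suc)
qed

text \<open>
  All exponents are at least \<open>2\<close>, and by induction the inner sums are bounded, so the increments are
  dominated by a multiple of \<open>1 / N\<^sup>2\<close>.
\<close>

lemma alt_trunc_convergent:
  assumes "\<forall>j\<in>set js. 0 < j"
  shows "convergent (\<lambda>N. alt_trunc N js)"
  using assms
proof (induction js)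
  case (Cons j js)
  then have "Bseq (\<lambda>N. alt_trunc N js)" by (simp add: convergent_imp_Bseq)
  then obtain K where K: "\<And>N. \<bar>alt_trunc N js\<bar> \<le> K" by (auto simp: Bseq_def)
  show ?case
  proof (rule summable_telescope_convergent)
    fix N
    have "real (Suc N) ^ 2 \<le> real (Suc N) ^ (2 * j)"
      using Cons.prems by (intro power_increasing) auto
    then have "\<bar>alt_trunc N js\<bar> / real (Suc N) ^ (2 * j) \<le> K / real (Suc N) ^ 2"
      using K[of N] by (intro frac_le) auto
    then show "\<bar>alt_trunc (Suc N) (j # js) - alt_trunc N (j # js)\<bar> \<le> K / real (Suc N) ^ 2"
      by (simp add: alt_trunc_Suc_Cons abs_mult power_abs del: of_nat_Suc power_Suc)
  qed (rule summable_shifted_inverse_squares)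
qed (simp add: convergent_const)

definition compositions :: "nat \<Rightarrow> nat \<Rightarrow> nat list set" where
  "compositions d n = {js. length js = d \<and> (\<forall>j\<in>set js. 0 < j) \<and> sum_list js = n}"

lemma compositions_0: "compositions 0 n = (if n = 0 then {[]} else {})"
  by (auto simp: compositions_def)

lemma compositions_Suc: "compositions (Suc d) n = (\<Union>j\<in>{1..n}. (#) j ` compositions d (n - j))"
  by (auto simp: compositions_def length_Suc_conv image_iff)

lemma finite_compositions: "finite (compositions d n)"
  by (induction d arbitrary: n) (simp_all add: compositions_0 compositions_Suc)

lemma sum_compositions_Suc:
  "(\<Sum>js\<in>compositions (Suc d) n. f js) = (\<Sum>j=1..n. \<Sum>js\<in>compositions d (n - j). f (j # js) :: real)"
  unfolding compositions_Suc
  by (subst sum.UNION_disjoint) (auto simp: finite_compositions sum.reindex inj_on_def)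

text \<open>
  With \<open>d\<close> entries equal to \<open>-1\<close> the sign vector of length \<open>d\<close> is determined. The limit defining each
  Euler sum exists, which permits one limit outside the finite sum over the compositions.
\<close>

lemma euler_A_full_eq:
  "euler_A d (2 * n) d = lim (\<lambda>N. \<Sum>js\<in>compositions d n. alt_trunc N js)"
proof -
  have cnt: "length eps = m \<Longrightarrow> count_list eps (-1) = m \<Longrightarrow> eps = replicate m (-1)" for eps :: "int list" and m
  proof (induction eps arbitrary: m)
    case (Cons e eps)
    then show ?case using count_le_length[of eps "-1"] by (auto split: if_splits)
  qed simp
  have cnt': "count_list (replicate m x) x = m" for m and x :: int
    by (induction m) auto
  have idx: "{(js, eps). length js = d \<and> (\<forall>j\<in>set js. j > 0) \<and> 2 * sum_list js = 2 * n \<and>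
      length eps = d \<and> set eps \<subseteq> {1, -1} \<and> count_list eps (-1) = d} =
      (\<lambda>js. (js, replicate d (-1 :: int))) ` compositions d n"
    by (auto simp: compositions_def image_iff cnt' intro: cnt)
  have summand: "euler_sum (map (\<lambda>j. 2 * j) js) (replicate d (-1)) = lim (\<lambda>N. alt_trunc N js)"
    if "js \<in> compositions d n" for js
    using that by (auto simp: euler_sum_def alt_trunc_def compositions_def intro!: arg_cong[of _ _ lim] ext sum.cong prod.cong)
  have "euler_A d (2 * n) d = (\<Sum>js\<in>compositions d n. lim (\<lambda>N. alt_trunc N js))"
    unfolding euler_A_def idx by (simp add: sum.reindex inj_on_def summand)
  also have "\<dots> = lim (\<lambda>N. \<Sum>js\<in>compositions d n. alt_trunc N js)"
    by (intro limI[symmetric] tendsto_sum)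
      (auto simp: compositions_def intro!: alt_trunc_convergent[unfolded convergent_LIMSEQ_iff])
  finally show ?thesis .
qed

text \<open>
  Both sides satisfy the same recursion in \<open>N\<close>: in the factor of index \<open>Suc N\<close> one takes either \<open>1\<close> or the
  term \<open>q\<^sup>j t\<^sup>j y\<close>, and on the right this is the choice whether the largest index is \<open>Suc N\<close>, with
  exponent \<open>2 j\<close>. The factor \<open>4 / \<pi>\<^sup>2\<close> comes from the normalisation of \<open>inv_root_all\<close>.
\<close>

lemma alt_prod_nth:
  "alt_prod N $ d $ n = (4 / pi\<^sup>2) ^ n * (\<Sum>js\<in>compositions d n. alt_trunc N js)"
proof (induction N arbitrary: d n)
  case 0
  show ?case
    by (cases d) (auto simp: alt_prod_def compositions_0 sum_compositions_Suc fps_one_def)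
next
  case (Suc N)
  have rec: "alt_prod (Suc N) = alt_prod N +
     fps_const (fps_const ((-1) ^ Suc N) * geo (inv_root_all (Suc N))) * (fps_X * alt_prod N)"
    by (simp add: alt_prod_def algebra_simps)
  show ?case
  proof (cases d)
    case 0
    then show ?thesis using Suc by (simp add: rec compositions_0)
  next
    case d: (Suc d')
    have root: "inv_root_all (Suc N) = 4 / pi\<^sup>2 / real (Suc N) ^ 2"
      by (simp add: inv_root_all_def power_divide power_mult_distrib)
    have "(geo (inv_root_all (Suc N)) * alt_prod N $ d') $ n =
        (\<Sum>j=1..n. inv_root_all (Suc N) ^ j * alt_prod N $ d' $ (n - j))"
      unfolding fps_mult_nth sum.atLeast_Suc_atMost[OF le0] by (simp add: geo_def)
    then have "(fps_const ((-1) ^ Suc N) * geo (inv_root_all (Suc N)) * alt_prod N $ d') $ n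
      = (-1) ^ Suc N * (\<Sum>j=1..n. inv_root_all (Suc N) ^ j * alt_prod N $ d' $ (n - j))"
      by (simp only: mult.assoc fps_mult_left_const_nth)
    also have "\<dots> = (4 / pi\<^sup>2) ^ n * (\<Sum>j=1..n. (-1) ^ Suc N / real (Suc N) ^ (2 * j) *
        (\<Sum>js\<in>compositions d' (n - j). alt_trunc N js))"
      unfolding sum_distrib_left[of "(-1) ^ Suc N"] sum_distrib_left[of "(4 / pi\<^sup>2) ^ n"]
    proof (intro sum.cong refl)
      fix j assume "j \<in> {1..n}"
      then have "(4 / pi\<^sup>2) ^ n = (4 / pi\<^sup>2) ^ j * (4 / pi\<^sup>2) ^ (n - j)"
        by (simp flip: power_add)
      then show "(-1) ^ Suc N * (inv_root_all (Suc N) ^ j * alt_prod N $ d' $ (n - j)) =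
        (4 / pi\<^sup>2) ^ n * ((-1) ^ Suc N / real (Suc N) ^ (2 * j) *
        (\<Sum>js\<in>compositions d' (n - j). alt_trunc N js))"
        unfolding Suc.IH root by (simp add: power_divide power_mult power_mult_distrib mult_ac del: power_Suc of_nat_Suc)
          (simp add: mult_ac del: power_Suc of_nat_Suc flip: power_mult)
    qed
    finally have *: "(fps_const ((-1) ^ Suc N) * geo (inv_root_all (Suc N)) * alt_prod N $ d') $ n =
      (4 / pi\<^sup>2) ^ n * (\<Sum>j=1..n. (-1) ^ Suc N / real (Suc N) ^ (2 * j) *
        (\<Sum>js\<in>compositions d' (n - j). alt_trunc N js))" .
    have "alt_prod (Suc N) $ d $ n = alt_prod N $ d $ n +
        (fps_const ((-1) ^ Suc N) * geo (inv_root_all (Suc N)) * alt_prod N $ d') $ n"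
      unfolding rec d by simp
    also have "\<dots> = (4 / pi\<^sup>2) ^ n * ((\<Sum>js\<in>compositions d n. alt_trunc N js) +
       (\<Sum>j=1..n. (-1) ^ Suc N / real (Suc N) ^ (2 * j) *
        (\<Sum>js\<in>compositions d' (n - j). alt_trunc N js)))"
      unfolding * Suc.IH by (simp only: distrib_left)
    also have "(\<Sum>js\<in>compositions d n. alt_trunc N js) +
       (\<Sum>j=1..n. (-1) ^ Suc N / real (Suc N) ^ (2 * j) *
        (\<Sum>js\<in>compositions d' (n - j). alt_trunc N js)) = (\<Sum>js\<in>compositions d n. alt_trunc (Suc N) js)"
      unfolding d sum_compositions_Suc alt_trunc_Suc_Cons sum.distrib sum_distrib_left ..
    finally show ?thesis .
  qed
qed

definition euler_A_fps :: "nat \<Rightarrow> real fps" where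
  "euler_A_fps d = Abs_fps (\<lambda>n. (4 / pi\<^sup>2) ^ n * euler_A d (2 * n) d)"

lemma coeffwise_lim_alt_prod: "coeffwise_lim (\<lambda>N. alt_prod N $ d) (euler_A_fps d)"
  unfolding coeffwise_lim_def alt_prod_nth euler_A_fps_def euler_A_full_eq fps_nth_Abs_fps
proof (intro allI tendsto_mult tendsto_const)
  fix n
  have "convergent (\<lambda>N. \<Sum>js\<in>compositions d n. alt_trunc N js)"
    by (intro convergent_sum alt_trunc_convergent) (auto simp: compositions_def)
  then show "(\<lambda>N. \<Sum>js\<in>compositions d n. alt_trunc N js) \<longlonglongrightarrow>
      lim (\<lambda>N. \<Sum>js\<in>compositions d n. alt_trunc N js)"
    by (simp add: convergent_LIMSEQ_iff)
qed

text \<open>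
  The finite identity \<open>linear_prod_mult_alt_prod_nth\<close> in the limit: the product \<open>sin \<theta> cos \<theta> / \<theta>\<close> times the
  generating function of depth \<open>d\<close> is the coefficient of \<open>y\<^sup>d\<close> in
  \<open>cos (\<theta> \<surd>(1 + y)) sin (\<theta> \<surd>(1 - y)) / (\<theta> \<surd>(1 - y))\<close>.
\<close>

lemma euler_A_fps_product:
  "fps_sinc_sqrt * fps_cos_sqrt * euler_A_fps d =
     (\<Sum>c=0..d. dilate 1 fps_cos_sqrt $ c * dilate (-1) fps_sinc_sqrt $ (d - c))"
proof (rule coeffwise_lim_unique)
  have sm: "strict_mono (\<lambda>M. 2 * M :: nat)" by (simp add: strict_mono_def)
  show "coeffwise_lim (\<lambda>M. linear_prod inv_root_all (2 * M) * alt_prod (2 * M) $ d)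
      (fps_sinc_sqrt * fps_cos_sqrt * euler_A_fps d)"
    by (intro coeffwise_lim_mult coeffwise_lim_subseq[OF linear_prod_inv_root_all sm]
        coeffwise_lim_subseq[OF coeffwise_lim_alt_prod sm])
  show "coeffwise_lim (\<lambda>M. linear_prod inv_root_all (2 * M) * alt_prod (2 * M) $ d)
      (\<Sum>c=0..d. dilate 1 fps_cos_sqrt $ c * dilate (-1) fps_sinc_sqrt $ (d - c))"
    unfolding linear_prod_mult_alt_prod_nth
    by (intro coeffwise_lim_sum coeffwise_lim_mult coeffwise_lim_dilate
        linear_prod_inv_root_even linear_prod_inv_root_odd)
qed

section \<open>Tangent and cotangent as generating functions of zeta values\<close>

text \<open>
  The logarithmic derivative of a product is the sum over its factors, and
  \<open>- q t / (1 - q t)\<close> is a geometric series; thus the power sums of the \<open>v k\<close> appear.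
\<close>

lemma X_deriv_linear_prod:
  "fps_X * fps_deriv (linear_prod v N) = - (linear_prod v N * (\<Sum>k=1..N. geo (v k)))"
proof (induction N)
  case (Suc N)
  define c where "c = v (Suc N)"
  have LP: "linear_prod v (Suc N) = linear_prod v N * (1 - fps_const c * fps_X)"
    by (simp add: linear_prod_def c_def)
  have "fps_X * fps_deriv (linear_prod v (Suc N)) =
      fps_X * fps_deriv (linear_prod v N) * (1 - fps_const c * fps_X) - linear_prod v N * (fps_const c * fps_X)"
    unfolding LP by (simp add: algebra_simps)
  also have "\<dots> = - (linear_prod v (Suc N) * (\<Sum>k=1..N. geo (v k)))
      - linear_prod v N * ((1 - fps_const c * fps_X) * geo c)"
    unfolding Suc geo_mult LP by (simp add: algebra_simps)
  finally show ?case by (simp add: LP c_def algebra_simps)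
qed simp

lemma coeffwise_lim_deriv:
  "coeffwise_lim F L \<Longrightarrow> coeffwise_lim (\<lambda>N. fps_deriv (F N)) (fps_deriv L)"
  unfolding coeffwise_lim_def by (auto intro!: tendsto_mult)

definition zeta_fps :: "real \<Rightarrow> real fps" where
  "zeta_fps c = Abs_fps (\<lambda>n. if n = 0 then 0 else c ^ n * zeta (2 * n) / pi ^ (2 * n))"

lemma zeta_sums:
  assumes "2 \<le> m" shows "(\<lambda>k. 1 / real (Suc k) ^ m) sums zeta m"
proof -
  have "summable (\<lambda>k. inverse (real (Suc k) ^ m))"
    using inverse_power_summable[of m, where 'a = real] assms by (subst summable_Suc_iff) simp
  then show ?thesis by (simp add: zeta_def summable_sums inverse_eq_divide del: of_nat_Suc)
qed

text \<open>
  For \<open>v k = c / (\<pi> k)\<^sup>2\<close> the power sums are partial sums of zeta values at even arguments.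
\<close>

lemma log_deriv_linear_prod_limit:
  assumes "coeffwise_lim (linear_prod (\<lambda>k. c / (pi * real k)\<^sup>2)) L"
  shows "fps_X * fps_deriv L = - (L * zeta_fps c)"
proof (rule coeffwise_lim_unique)
  let ?v = "\<lambda>k. c / (pi * real k)\<^sup>2"
  show "coeffwise_lim (\<lambda>N. fps_X * fps_deriv (linear_prod ?v N)) (fps_X * fps_deriv L)"
    by (intro coeffwise_lim_mult coeffwise_lim_deriv assms) (simp add: coeffwise_lim_def)
  have "coeffwise_lim (\<lambda>N. \<Sum>k=1..N. geo (?v k)) (zeta_fps c)"
    unfolding coeffwise_lim_def
  proof
    fix n
    show "(\<lambda>N. (\<Sum>k=1..N. geo (?v k)) $ n) \<longlonglongrightarrow> zeta_fps c $ n"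
    proof (cases "n = 0")
      case False
      then have "(\<lambda>k. c ^ n / pi ^ (2 * n) * (1 / real (Suc k) ^ (2 * n))) sums
          (c ^ n / pi ^ (2 * n) * zeta (2 * n))"
        by (intro sums_mult zeta_sums) simp
      then have "(\<lambda>N. \<Sum>k<N. ?v (Suc k) ^ n) \<longlonglongrightarrow> c ^ n / pi ^ (2 * n) * zeta (2 * n)"
        unfolding sums_def by (simp add: power_divide power_mult_distrib power_mult)
      then show ?thesis using False
        by (simp add: fps_sum_nth geo_def zeta_fps_def sum.atLeast1_atMost_eq)
    qed (simp add: fps_sum_nth geo_def zeta_fps_def)
  qed
  from coeffwise_lim_mult[OF coeffwise_lim_mult[OF assms this], of "\<lambda>_. -1" "-1"]
  show "coeffwise_lim (\<lambda>N. fps_X * fps_deriv (linear_prod ?v N)) (- (L * zeta_fps c))"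
    unfolding X_deriv_linear_prod by (simp add: coeffwise_lim_def)
qed

lemma fps_sinc_sqrt_nonzero: "fps_sinc_sqrt \<noteq> 0"
proof -
  have "fps_sinc_sqrt $ 0 \<noteq> 0" by (simp add: fps_sinc_sqrt_def)
  then show ?thesis by force
qed

lemma fps_cos_sqrt_nonzero: "fps_cos_sqrt \<noteq> 0"
proof -
  have "fps_cos_sqrt $ 0 \<noteq> 0" by (simp add: fps_cos_sqrt_def)
  then show ?thesis by force
qed

text \<open>
  With \<open>t = \<theta>\<^sup>2\<close> and \<open>w = \<surd>(1 + y)\<close> this is \<open>\<partial>/\<partial>\<theta> (sin (\<theta> w) / w) = cos (\<theta> w)\<close>, as the operator
  \<open>F + 2 t F'\<close> is the derivative of \<open>\<theta> F\<close> with respect to \<open>\<theta>\<close>.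
\<close>

lemma dilate_sinc_sqrt_ode:
  "dilate 1 fps_sinc_sqrt $ c + 2 * fps_X * fps_deriv (dilate 1 fps_sinc_sqrt $ c) = dilate 1 fps_cos_sqrt $ c"
proof (rule fps_ext)
  fix n
  have "(dilate 1 fps_sinc_sqrt $ c + fps_const 2 * (fps_X * fps_deriv (dilate 1 fps_sinc_sqrt $ c))) $ n =
    (dilate 1 fps_cos_sqrt $ c) $ n"
  proof -
    have A: "(F + fps_const 2 * (fps_X * fps_deriv F)) $ n = real (2 * n + 1) * F $ n" for F :: "real fps"
      by (cases n) (simp_all add: algebra_simps)
    have B: "real (2 * n + 1) * dilate 1 fps_sinc_sqrt $ c $ n = dilate 1 fps_cos_sqrt $ c $ n"
      by (simp add: fps_sinc_sqrt_def fps_cos_sqrt_def del: of_nat_Suc)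
    show ?thesis by (rule trans[OF A B])
  qed
  then show "(dilate 1 fps_sinc_sqrt $ c + 2 * fps_X * fps_deriv (dilate 1 fps_sinc_sqrt $ c)) $ n =
    (dilate 1 fps_cos_sqrt $ c) $ n"
    by (simp add: numeral_fps_const mult.assoc)
qed

lemma dilate_0 [simp]: "dilate s F $ 0 = F"
  by (simp add: fps_eq_iff)

lemma fps_sinc_sqrt_ode: "fps_sinc_sqrt + 2 * fps_X * fps_deriv fps_sinc_sqrt = fps_cos_sqrt"
  using dilate_sinc_sqrt_ode[of 0] by simp

lemma fps_cos_sqrt_ode: "2 * fps_deriv fps_cos_sqrt = - fps_sinc_sqrt"
proof (rule fps_ext)
  fix n
  have "(fps_const 2 * fps_deriv fps_cos_sqrt) $ n = (- fps_sinc_sqrt) $ n"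
  proof -
    have "(fact (2 * Suc n) :: real) = 2 * real (Suc n) * fact (2 * n + 1)" by simp
    then show ?thesis by (simp add: fps_sinc_sqrt_def fps_cos_sqrt_def del: of_nat_Suc fact_Suc mult_Suc_right)
  qed
  then show "(2 * fps_deriv fps_cos_sqrt) $ n = (- fps_sinc_sqrt) $ n" by (simp add: numeral_fps_const)
qed

text \<open>
  The coefficient form of \<open>\<partial>/\<partial>y cos (\<theta> w) = - (\<theta> / 2) sin (\<theta> w) / w\<close> with \<open>w = \<surd>(1 + y)\<close>.
\<close>

lemma dilate_cos_sqrt_Suc:
  "dilate 1 fps_cos_sqrt $ Suc c = fps_const (- 1 / (2 * real (Suc c))) * (fps_X * (dilate 1 fps_sinc_sqrt $ c))"
proof (rule fps_ext)
  fix n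
  show "dilate 1 fps_cos_sqrt $ Suc c $ n =
      (fps_const (- 1 / (2 * real (Suc c))) * (fps_X * (dilate 1 fps_sinc_sqrt $ c))) $ n"
  proof (cases n)
    case (Suc m)
    have "real (Suc c) * real (Suc m choose Suc c) = real (Suc m) * real (m choose c)"
      using binomial_absorption[of c "Suc m"] by (metis diff_Suc_1 of_nat_mult)
    then have "real (Suc m choose Suc c) = real (Suc m) * real (m choose c) / real (Suc c)"
      by (simp add: field_simps del: of_nat_Suc binomial_Suc_Suc)
    moreover have "fact (2 * Suc m) = (2 * real (Suc m)) * fact (2 * m + 1)" by simp
    ultimately show ?thesis unfolding Suc
      by (simp add: fps_sinc_sqrt_def fps_cos_sqrt_def del: of_nat_Suc binomial_Suc_Suc fact_Suc mult_Suc_right)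
  qed simp
qed

text \<open>
  This says that \<open>\<theta> cot \<theta>\<close> equals \<open>1 - 2 (\<zeta>(2) \<theta>\<^sup>2 / \<pi>\<^sup>2 + \<zeta>(4) \<theta>\<^sup>4 / \<pi>\<^sup>4 + \<dots>)\<close>.
\<close>

lemma cos_sqrt_eq_sinc_sqrt_zeta: "fps_cos_sqrt = fps_sinc_sqrt * (1 - 2 * zeta_fps 1)"
proof -
  have "fps_X * fps_deriv fps_sinc_sqrt = - (fps_sinc_sqrt * zeta_fps 1)"
    using log_deriv_linear_prod_limit[of 1] linear_prod_inv_root_even
    by (simp add: inv_root_even_def[abs_def] power_divide)
  then show ?thesis unfolding fps_sinc_sqrt_ode[symmetric] mult.assoc by (simp add: algebra_simps)
qed

text \<open>
  The corresponding expansion of \<open>\<theta> tan \<theta>\<close>. The logarithmic derivative of \<open>cos \<theta>\<close> is the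
  difference of those of \<open>sin (2 \<theta>) / (2 \<theta>)\<close> and \<open>sin \<theta> / \<theta>\<close>, whose zeta series are scaled by \<open>4\<close> and \<open>1\<close>.
\<close>

lemma X_sinc_sqrt_eq_cos_sqrt_zeta: "fps_X * fps_sinc_sqrt = 2 * fps_cos_sqrt * (zeta_fps 4 - zeta_fps 1)"
proof -
  have even: "fps_X * fps_deriv fps_sinc_sqrt = - (fps_sinc_sqrt * zeta_fps 1)"
    using log_deriv_linear_prod_limit[of 1] linear_prod_inv_root_even
    by (simp add: inv_root_even_def[abs_def] power_divide)
  have all: "fps_X * fps_deriv (fps_sinc_sqrt * fps_cos_sqrt) = - (fps_sinc_sqrt * fps_cos_sqrt * zeta_fps 4)"
    by (rule log_deriv_linear_prod_limit)
      (use linear_prod_inv_root_all in \<open>simp add: inv_root_all_def[abs_def] power_divide\<close>)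
  have "fps_sinc_sqrt * (fps_X * fps_sinc_sqrt) = - 2 * fps_sinc_sqrt * (fps_X * fps_deriv fps_cos_sqrt)"
    using arg_cong[OF fps_cos_sqrt_ode, of "\<lambda>F. - (fps_sinc_sqrt * (fps_X * F))"] by (simp add: algebra_simps)
  also have "\<dots> = - 2 * (fps_X * fps_deriv (fps_sinc_sqrt * fps_cos_sqrt) - fps_X * fps_deriv fps_sinc_sqrt * fps_cos_sqrt)"
    by (simp add: algebra_simps)
  also have "\<dots> = fps_sinc_sqrt * (2 * fps_cos_sqrt * (zeta_fps 4 - zeta_fps 1))"
    unfolding even all by (simp add: algebra_simps)
  finally show ?thesis using fps_sinc_sqrt_nonzero by simp
qed

section \<open>Bessel-type polynomials\<close>

text \<open>
  With \<open>w = \<surd>(1 + y)\<close>, the coefficient of \<open>y\<^sup>c\<close> in \<open>sin (\<theta> w) / w\<close> is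
  \<open>sin \<theta> bessel_sin c(\<theta>\<^sup>2) + \<theta> cos \<theta> bessel_cos c(\<theta>\<^sup>2)\<close>; up to scaling it is a spherical Bessel function.
  The two polynomials are the even and the odd part of a single polynomial in \<open>\<theta>\<close> whose coefficient of
  \<open>\<theta>\<^sup>m\<close> is a sign times \<open>((2 c - m) choose c) 2\<^sup>m / (4\<^sup>c m!)\<close>. The bound on \<open>k\<close> gives
  the values \<open>1\<close> and \<open>0\<close> at \<open>c = 0\<close>; beyond it the binomial coefficient vanishes if \<open>c\<close> is positive.
\<close>

definition bessel_sin :: "nat \<Rightarrow> real fps" where
  "bessel_sin c = Abs_fps (\<lambda>k. if 2 * k \<le> c
     then (-1) ^ (c + k) * real ((2 * c - 2 * k) choose c) * 2 ^ (2 * k) / (4 ^ c * fact (2 * k)) else 0)"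

definition bessel_cos :: "nat \<Rightarrow> real fps" where
  "bessel_cos c = Abs_fps (\<lambda>k. if 2 * k + 1 \<le> c
     then (-1) ^ (c + k + 1) * real ((2 * c - 2 * k - 1) choose c) * 2 ^ (2 * k + 1) / (4 ^ c * fact (2 * k + 1)) else 0)"

text \<open>
  The recurrence behind both of the differential equations below, at an odd \<open>m\<close> for the first and an even
  \<open>m\<close> for the second: by Pascal's rule the difference is \<open>N choose Suc b\<close> minus \<open>N choose b\<close> with
  \<open>N = 2 b + 1 - m\<close>, and absorption makes the two terms proportional.
\<close>

lemma binomial_double_step:
  assumes "m < 2 * Suc b"
  shows "real (Suc b) * (2 * real ((2 * Suc b - Suc m) choose Suc b) - real ((2 * Suc b - m) choose Suc b))
     = - real m * real ((2 * Suc b - Suc m) choose b)"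
proof -
  define N where "N = 2 * Suc b - Suc m"
  have SN: "2 * Suc b - m = Suc N" using assms by (simp add: N_def)
  have rN: "real N = 2 * real (Suc b) - real m - 1" using assms by (simp add: N_def)
  have "real (Suc b) * real (N choose Suc b) = (real N - real b) * real (N choose b)"
  proof (cases "b \<le> N")
    case True
    have "Suc b * (N choose Suc b) = (N - b) * (N choose b)"
      using binomial_absorption[of b N] binomial_absorb_comp[of N b] by simp
    then show ?thesis using True by (metis of_nat_diff of_nat_mult)
  qed (simp add: binomial_eq_0)
  then show ?thesis unfolding SN N_def[symmetric] using rN by (simp add: algebra_simps)
qed

lemma bessel_sin_nth_Suc:
  "bessel_sin (Suc b) $ k = (-1) ^ (Suc b + k) * real ((2 * Suc b - 2 * k) choose Suc b) * 2 ^ (2 * k)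
     / (4 ^ Suc b * fact (2 * k))"
  by (simp add: bessel_sin_def binomial_eq_0 del: binomial_Suc_Suc)

lemma bessel_cos_nth_Suc:
  "bessel_cos (Suc b) $ k = (-1) ^ (Suc b + k + 1) * real ((2 * Suc b - Suc (2 * k)) choose Suc b) * 2 ^ (2 * k + 1)
     / (4 ^ Suc b * fact (2 * k + 1))"
  by (auto simp add: bessel_cos_def binomial_eq_0 simp del: binomial_Suc_Suc)

text \<open>
  This lemma and the next one compare the coefficients of \<open>sin \<theta>\<close> and \<open>cos \<theta>\<close> after differentiating
  \<open>sin \<theta> bessel_sin + \<theta> cos \<theta> bessel_cos\<close> in the differential equation satisfied by
  \<open>dilate 1 fps_sinc_sqrt\<close>.
\<close>

lemma bessel_sin_cos_Suc_1:
  "2 * fps_deriv (bessel_sin (Suc b)) - bessel_cos (Suc b) =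
     fps_const (- 1 / (2 * real (Suc b))) * bessel_sin b"
proof (rule fps_ext)
  fix k
  define C1 where "C1 = real ((2 * Suc b - 2 * Suc k) choose Suc b)"
  define C2 where "C2 = real ((2 * Suc b - Suc (2 * k)) choose Suc b)"
  have f2: "(fact (2 * Suc k) :: real) = 2 * real (Suc k) * fact (2 * k + 1)" by simp
  have "(2 * fps_deriv (bessel_sin (Suc b)) - bessel_cos (Suc b)) $ k
    = 2 * real (Suc k) * bessel_sin (Suc b) $ Suc k - bessel_cos (Suc b) $ k"
    by (simp add: numeral_fps_const)
  also have "\<dots> = (-1) ^ (b + k) * 2 ^ (2 * k + 1) * (2 * C1 - C2) / (4 ^ Suc b * fact (2 * k + 1))"
    unfolding bessel_sin_nth_Suc bessel_cos_nth_Suc C1_def[symmetric] C2_def[symmetric] f2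
    by (simp add: divide_simps del: of_nat_Suc fact_Suc) (simp add: algebra_simps)
  also have "\<dots> = - 1 / (2 * real (Suc b)) * bessel_sin b $ k"
  proof (cases "2 * k \<le> b")
    case True
    have "real (Suc b) * (2 * C1 - C2) = - real (2 * k + 1) * real ((2 * b - 2 * k) choose b)"
      using binomial_double_step[of "2 * k + 1" b] True by (simp add: C1_def C2_def del: binomial_Suc_Suc)
    then have "2 * C1 - C2 = - real (2 * k + 1) * real ((2 * b - 2 * k) choose b) / real (Suc b)"
      by (simp add: field_simps del: of_nat_Suc)
    moreover have "(fact (2 * k + 1) :: real) = real (2 * k + 1) * fact (2 * k)" by simp
    ultimately show ?thesis using True by (simp add: bessel_sin_def mult_ac del: of_nat_Suc fact_Suc)
  qed (simp add: bessel_sin_def C1_def C2_def binomial_eq_0 del: binomial_Suc_Suc)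
  finally show "(2 * fps_deriv (bessel_sin (Suc b)) - bessel_cos (Suc b)) $ k =
     (fps_const (- 1 / (2 * real (Suc b))) * bessel_sin b) $ k" by simp
qed

lemma bessel_sin_cos_Suc_2:
  "bessel_sin (Suc b) + bessel_cos (Suc b) + 2 * fps_X * fps_deriv (bessel_cos (Suc b)) =
     fps_const (- 1 / (2 * real (Suc b))) * (fps_X * bessel_cos b)"
proof (rule fps_ext)
  fix k
  define C1 where "C1 = real ((2 * Suc b - Suc (2 * k)) choose Suc b)"
  define C2 where "C2 = real ((2 * Suc b - 2 * k) choose Suc b)"
  have f2: "(fact (2 * k + 1) :: real) = real (2 * k + 1) * fact (2 * k)" by simp
  have "(bessel_sin (Suc b) + bessel_cos (Suc b) + 2 * fps_X * fps_deriv (bessel_cos (Suc b))) $ k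
    = bessel_sin (Suc b) $ k + real (2 * k + 1) * bessel_cos (Suc b) $ k"
    by (cases k) (simp_all add: numeral_fps_const mult.assoc algebra_simps)
  also have "\<dots> = (-1) ^ (b + k) * 2 ^ (2 * k) * (2 * C1 - C2) / (4 ^ Suc b * fact (2 * k))"
    unfolding bessel_sin_nth_Suc bessel_cos_nth_Suc C1_def[symmetric] C2_def[symmetric] f2
    by (simp add: divide_simps del: of_nat_Suc fact_Suc) (simp add: algebra_simps)
  also have "\<dots> = - 1 / (2 * real (Suc b)) * (fps_X * bessel_cos b) $ k"
  proof (cases "k \<le> b")
    case True
    have "real (Suc b) * (2 * C1 - C2) = - (2 * real k) * real ((2 * Suc b - Suc (2 * k)) choose b)"
      using binomial_double_step[of "2 * k" b] True unfolding C1_def C2_def by simp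
    then have eq: "2 * C1 - C2 = - (2 * real k) * real ((2 * Suc b - Suc (2 * k)) choose b) / real (Suc b)"
      by (simp add: field_simps del: of_nat_Suc)
    show ?thesis
    proof (cases k)
      case 0 then show ?thesis using eq by simp
    next
      case (Suc l)
      have f3: "(fact (2 * k) :: real) = 2 * real k * fact (2 * l + 1)" by (simp add: Suc)
      have m: "2 * Suc b - Suc (2 * k) = 2 * b - 2 * l - 1" using Suc by simp
      have "bessel_cos b $ l = - ((-1) ^ (b + l) * real ((2 * b - 2 * l - 1) choose b) * 2 ^ (2 * l + 1) /
          (4 ^ b * fact (2 * l + 1)))"
        using True Suc by (auto simp: bessel_cos_def binomial_eq_0)
      then have "- 1 / (2 * real (Suc b)) * (fps_X * bessel_cos b) $ k =
          (-1) ^ (b + l) * real ((2 * b - 2 * l - 1) choose b) * 2 ^ (2 * l) /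
          (real (Suc b) * (4 ^ b * fact (2 * l + 1)))"
        by (simp add: Suc mult_ac del: of_nat_Suc fact_Suc)
      moreover have "(-1 :: real) ^ (b + k) = - ((-1) ^ (b + l))" "(2 :: real) ^ (2 * k) = 4 * 2 ^ (2 * l)"
        using Suc by simp_all
      moreover have "real k \<noteq> 0" using Suc by simp
      ultimately show ?thesis unfolding eq f3 m by (simp add: mult_ac del: of_nat_Suc fact_Suc)
    qed
  next
    case False
    then have "bessel_cos b $ (k - 1) = 0" by (auto simp: bessel_cos_def)
    then show ?thesis using False by (simp add: C1_def C2_def binomial_eq_0 del: binomial_Suc_Suc)
  qed
  finally show "(bessel_sin (Suc b) + bessel_cos (Suc b) + 2 * fps_X * fps_deriv (bessel_cos (Suc b))) $ k =
     (fps_const (- 1 / (2 * real (Suc b))) * (fps_X * bessel_cos b)) $ k" by simp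
qed

lemma fps_ode_unique:
  fixes F G :: "real fps"
  assumes "F + 2 * fps_X * fps_deriv F = G + 2 * fps_X * fps_deriv G"
  shows "F = G"
proof (rule fps_ext)
  fix n
  have "(F + 2 * fps_X * fps_deriv F) $ n = real (2 * n + 1) * F $ n" for F :: "real fps"
    by (cases n) (simp_all add: algebra_simps numeral_fps_const)
  then have "real (2 * n + 1) * F $ n = real (2 * n + 1) * G $ n" using assms by metis
  then show "F $ n = G $ n" by (simp del: of_nat_add of_nat_mult of_nat_Suc)
qed

text \<open>
  By induction on \<open>c\<close>, both sides satisfy the same first-order differential equation, which has a unique
  power series solution: the derivative of \<open>sin (\<theta> w) / w\<close> is \<open>cos (\<theta> w)\<close>, whose coefficient of
  \<open>y\<^sup>c\<close> is a multiple of the coefficient of \<open>y\<^sup>c\<^sup>-\<^sup>1\<close> in \<open>sin (\<theta> w) / w\<close>.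
\<close>

lemma dilate_sinc_sqrt_nth:
  "dilate 1 fps_sinc_sqrt $ c = fps_sinc_sqrt * bessel_sin c + fps_cos_sqrt * bessel_cos c"
proof (induction c)
  case 0
  have "bessel_sin 0 = 1" "bessel_cos 0 = 0"
    by (auto simp: fps_eq_iff bessel_sin_def bessel_cos_def)
  then show ?case by simp
next
  case (Suc b)
  define u v where "u = bessel_sin (Suc b)" and "v = bessel_cos (Suc b)"
  define q where "q = fps_const (- 1 / (2 * real (Suc b)))"
  let ?F = "fps_sinc_sqrt * u + fps_cos_sqrt * v"
  have "?F + 2 * fps_X * fps_deriv ?F =
      (fps_sinc_sqrt + 2 * fps_X * fps_deriv fps_sinc_sqrt) * u + fps_sinc_sqrt * (2 * fps_X * fps_deriv u)
      + fps_cos_sqrt * v + fps_X * (2 * fps_deriv fps_cos_sqrt) * v + fps_cos_sqrt * (2 * fps_X * fps_deriv v)"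
    by (simp add: algebra_simps)
  also have "\<dots> = fps_X * fps_sinc_sqrt * (2 * fps_deriv u - v) + fps_cos_sqrt * (u + v + 2 * fps_X * fps_deriv v)"
    unfolding fps_sinc_sqrt_ode fps_cos_sqrt_ode by (simp add: algebra_simps)
  also have "\<dots> = q * (fps_X * (dilate 1 fps_sinc_sqrt $ b))"
    unfolding u_def v_def bessel_sin_cos_Suc_1 bessel_sin_cos_Suc_2 Suc q_def
    by (simp add: algebra_simps)
  also have "\<dots> = dilate 1 fps_sinc_sqrt $ Suc b + 2 * fps_X * fps_deriv (dilate 1 fps_sinc_sqrt $ Suc b)"
    unfolding dilate_sinc_sqrt_ode dilate_cos_sqrt_Suc q_def ..
  finally show ?case unfolding u_def v_def by (rule fps_ode_unique[OF sym])
qed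

lemma dilate_minus_sinc_sqrt_nth: "dilate (-1) F $ c = (-1) ^ c * dilate 1 F $ c"
proof -
  have eq: "((-1) ^ c :: real fps) = fps_const ((-1) ^ c)" by (induction c) (auto simp: fps_eq_iff)
  show ?thesis unfolding eq by (simp add: fps_eq_iff)
qed

text \<open>
  Inserting the Bessel-type polynomials into \<open>euler_A_fps_product\<close> and cancelling \<open>sin \<theta> cos \<theta>\<close>: a product
  of two sines leaves a tangent, of two cosines a cotangent, and a mixed product only a polynomial. The
  summand \<open>c = 0\<close> stands apart because the constant coefficient in \<open>y\<close> of \<open>cos (\<theta> \<surd>(1 + y))\<close> is
  \<open>cos \<theta>\<close> itself.
\<close>

lemma euler_A_fps_closed_form:
  "euler_A_fps d = (-1) ^ d * (bessel_sin d + (1 - 2 * zeta_fps 1) * bessel_cos d) +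
     (\<Sum>c=1..d. (-1) ^ (d - c) * fps_const (- 1 / (2 * real c)) *
        (2 * (zeta_fps 4 - zeta_fps 1) * bessel_sin (c - 1) * bessel_sin (d - c)
          + fps_X * (bessel_sin (c - 1) * bessel_cos (d - c) + bessel_cos (c - 1) * bessel_sin (d - c))
          + fps_X * (1 - 2 * zeta_fps 1) * bessel_cos (c - 1) * bessel_cos (d - c)))"
    (is "_ = ?A d + (\<Sum>c=1..d. ?B c)")
proof -
  define Ze Zo where "Ze = zeta_fps 1" and "Zo = zeta_fps 4 - zeta_fps 1"
  have cos: "fps_cos_sqrt = fps_sinc_sqrt * (1 - 2 * Ze)" and sin: "fps_X * fps_sinc_sqrt = 2 * fps_cos_sqrt * Zo"
    unfolding Ze_def Zo_def by (fact cos_sqrt_eq_sinc_sqrt_zeta X_sinc_sqrt_eq_cos_sqrt_zeta)+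
  \<comment> \<open>The summand \<open>c = 0\<close>.\<close>
  have zero: "fps_cos_sqrt * ((-1) ^ d * dilate 1 fps_sinc_sqrt $ d) = fps_sinc_sqrt * fps_cos_sqrt * ?A d"
  proof -
    have "fps_cos_sqrt * ((-1) ^ d * dilate 1 fps_sinc_sqrt $ d) =
      (-1) ^ d * (fps_sinc_sqrt * fps_cos_sqrt * bessel_sin d + fps_cos_sqrt * bessel_cos d * fps_cos_sqrt)"
      unfolding dilate_sinc_sqrt_nth by (simp add: algebra_simps)
    also have "\<dots> = (-1) ^ d * (fps_sinc_sqrt * fps_cos_sqrt * bessel_sin d +
        fps_cos_sqrt * bessel_cos d * (fps_sinc_sqrt * (1 - 2 * Ze)))"
      using cos by metis
    finally show ?thesis unfolding Ze_def by (simp add: algebra_simps)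
  qed
  \<comment> \<open>The summands \<open>c \<ge> 1\<close>.\<close>
  have pos: "dilate 1 fps_cos_sqrt $ c * ((-1) ^ (d - c) * dilate 1 fps_sinc_sqrt $ (d - c)) =
      fps_sinc_sqrt * fps_cos_sqrt * ?B c" if c: "c \<in> {1..d}" for c
  proof -
    obtain b where b: "c = Suc b" using c by (cases c) auto
    define u v u' v' where "u = bessel_sin b" and "v = bessel_cos b"
      and "u' = bessel_sin (d - c)" and "v' = bessel_cos (d - c)"
    have "fps_X * (fps_sinc_sqrt * u + fps_cos_sqrt * v) * (fps_sinc_sqrt * u' + fps_cos_sqrt * v') =
      (fps_X * fps_sinc_sqrt) * fps_sinc_sqrt * u * u' + fps_sinc_sqrt * fps_cos_sqrt * (fps_X * (u * v' + v * u'))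
       + fps_cos_sqrt * (fps_X * fps_cos_sqrt * v * v')" by (simp add: algebra_simps)
    also have "\<dots> = (2 * fps_cos_sqrt * Zo) * fps_sinc_sqrt * u * u' + fps_sinc_sqrt * fps_cos_sqrt * (fps_X * (u * v' + v * u'))
       + (fps_sinc_sqrt * (1 - 2 * Ze)) * (fps_X * fps_cos_sqrt * v * v')"
      unfolding sin using cos by metis
    also have "\<dots> = fps_sinc_sqrt * fps_cos_sqrt * (2 * Zo * u * u' + fps_X * (u * v' + v * u')
        + fps_X * (1 - 2 * Ze) * v * v')" by (simp add: algebra_simps)
    finally have main: "fps_X * (fps_sinc_sqrt * u + fps_cos_sqrt * v) * (fps_sinc_sqrt * u' + fps_cos_sqrt * v') = \<dots>" .
    have "dilate 1 fps_cos_sqrt $ c * ((-1) ^ (d - c) * dilate 1 fps_sinc_sqrt $ (d - c)) =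
      (-1) ^ (d - c) * fps_const (- 1 / (2 * real c)) *
        (fps_X * (fps_sinc_sqrt * u + fps_cos_sqrt * v) * (fps_sinc_sqrt * u' + fps_cos_sqrt * v'))"
      unfolding b dilate_cos_sqrt_Suc unfolding dilate_sinc_sqrt_nth u_def v_def u'_def v'_def
      by (simp only: b mult_ac)
    also have "\<dots> = (-1) ^ (d - c) * fps_const (- 1 / (2 * real c)) *
        (fps_sinc_sqrt * fps_cos_sqrt * (2 * Zo * u * u' + fps_X * (u * v' + v * u') + fps_X * (1 - 2 * Ze) * v * v'))"
      by (simp only: main)
    finally show ?thesis unfolding u_def v_def u'_def v'_def Ze_def Zo_def
      by (simp only: b diff_Suc_1 mult_ac)
  qed
  have "fps_sinc_sqrt * fps_cos_sqrt * euler_A_fps d =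
      dilate 1 fps_cos_sqrt $ 0 * ((-1) ^ d * dilate 1 fps_sinc_sqrt $ d) +
      (\<Sum>c=1..d. dilate 1 fps_cos_sqrt $ c * ((-1) ^ (d - c) * dilate 1 fps_sinc_sqrt $ (d - c)))"
    unfolding euler_A_fps_product dilate_minus_sinc_sqrt_nth[of fps_sinc_sqrt]
    by (simp add: sum.atLeast_Suc_atMost)
  also have "\<dots> = fps_sinc_sqrt * fps_cos_sqrt * (?A d + (\<Sum>c=1..d. ?B c))"
  proof -
    have "(\<Sum>c=1..d. dilate 1 fps_cos_sqrt $ c * ((-1) ^ (d - c) * dilate 1 fps_sinc_sqrt $ (d - c))) =
        fps_sinc_sqrt * fps_cos_sqrt * (\<Sum>c=1..d. ?B c)"
      unfolding sum_distrib_left by (rule sum.cong[OF refl pos])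
    then show ?thesis unfolding dilate_0 zero by (simp only: distrib_left)
  qed
  finally show ?thesis
    using fps_sinc_sqrt_nonzero fps_cos_sqrt_nonzero by simp
qed

section \<open>Extraction of the coefficients\<close>

lemma fps_mult_nth_left_support:
  fixes A Z :: "real fps"
  assumes "\<And>j. j \<notin> J \<Longrightarrow> A $ j = 0" and "finite J" and "\<And>j. j \<in> J \<Longrightarrow> j \<le> n"
  shows "(A * Z) $ n = (\<Sum>j\<in>J. A $ j * Z $ (n - j))"
  unfolding fps_mult_nth
  by (rule sum.mono_neutral_right) (use assms in auto)

lemma fps_mult3_nth_support:
  fixes A B Z :: "real fps"
  assumes A: "\<And>j. j \<notin> J \<Longrightarrow> A $ j = 0" "finite J"
    and B: "\<And>k. k \<notin> K \<Longrightarrow> B $ k = 0" "finite K"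
    and le: "\<And>j k. j \<in> J \<Longrightarrow> k \<in> K \<Longrightarrow> j + k \<le> n"
  shows "(A * B * Z) $ n = (\<Sum>j\<in>J. \<Sum>k\<in>K. A $ j * B $ k * Z $ (n - j - k))"
proof (cases "K = {}")
  case True
  then have "B = 0" using B by (simp add: fps_eq_iff)
  then show ?thesis using True by simp
next
  case False
  have len: "j \<le> n" if "j \<in> J" for j using False le[OF that] by (auto dest: add_leD1)
  have "(A * (B * Z)) $ n = (\<Sum>j\<in>J. A $ j * (B * Z) $ (n - j))"
    by (rule fps_mult_nth_left_support) (use A len in auto)
  also have "\<dots> = (\<Sum>j\<in>J. A $ j * (\<Sum>k\<in>K. B $ k * Z $ (n - j - k)))"
  proof (intro sum.cong refl arg_cong2[of _ _ _ _ "(*)"] fps_mult_nth_left_support B)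
    fix j k assume "j \<in> J" "k \<in> K"
    then show "k \<le> n - j" using le[of j k] by simp
  qed
  finally show ?thesis by (simp add: sum_distrib_left mult.assoc)
qed

text \<open>
  Degrees are measured in \<open>\<theta>\<close>: the bounds say that \<open>A(\<theta>\<^sup>2)\<close> has degree at most \<open>p\<close> and \<open>\<theta> B(\<theta>\<^sup>2)\<close> degree at
  most \<open>q\<close>.
\<close>

lemma fps_mult_nth_eq_0_support:
  fixes A B :: "real fps"
  assumes "\<And>j. 2 * j > p \<Longrightarrow> A $ j = 0" "\<And>k. 2 * k + 1 > q \<Longrightarrow> B $ k = 0" "2 * m + 1 > p + q"
  shows "(A * B) $ m = 0"
  unfolding fps_mult_nth
proof (intro sum.neutral ballI)
  fix i assume "i \<in> {0..m}"
  then have "2 * i > p \<or> 2 * (m - i) + 1 > q" using assms(3) by auto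
  then show "A $ i * B $ (m - i) = 0" using assms(1,2) by auto
qed

lemma bessel_sin_nth_eq_0: "2 * k > c \<Longrightarrow> bessel_sin c $ k = 0"
  by (simp add: bessel_sin_def)

lemma bessel_cos_nth_eq_0: "2 * k + 1 > c \<Longrightarrow> bessel_cos c $ k = 0"
  by (simp add: bessel_cos_def)

lemma minus_one_power_mult_nth: "((-1) ^ d * F) $ n = (-1) ^ d * F $ n" for F :: "real fps"
proof -
  have eq: "((-1) ^ d :: real fps) = fps_const ((-1) ^ d)" by (induction d) (auto simp: fps_eq_iff)
  show ?thesis unfolding eq by simp
qed

lemma minus_one_sign_cancel: "(-1) ^ e * ((-1) ^ (e + k) * x) = (-1) ^ k * (x :: real)"
  by (simp add: power_add flip: mult.assoc power_mult_distrib)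

text \<open>
  Since \<open>n \<ge> d\<close>, the order \<open>n\<close> exceeds the degree of every purely polynomial part, and only the products with
  a zeta series contribute.
\<close>

lemma euler_A_fps_nth:
  assumes d: "1 \<le> d" "d \<le> n"
  shows "euler_A_fps d $ n =
     (\<Sum>j=0..(d - 1) div 2. (-1) ^ d * (- 2) * (bessel_cos d $ j * zeta_fps 1 $ (n - j)))
   + (\<Sum>c=1..d. \<Sum>j=0..(c - 1) div 2. \<Sum>k=0..(d - c) div 2. (-1) ^ (d - c) * (- 1 / real c) *
        (bessel_sin (c - 1) $ j * bessel_sin (d - c) $ k * (zeta_fps 4 - zeta_fps 1) $ (n - j - k)))
   + (\<Sum>c=1..d. \<Sum>j=1..c div 2. \<Sum>k | int k \<le> (int d - int c - 1) div 2.
        (-1) ^ (d - c) * (1 / real c) *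
        (bessel_cos (c - 1) $ (j - 1) * bessel_cos (d - c) $ k * zeta_fps 1 $ (n - j - k)))"
proof -
  define Ze Zo where "Ze = zeta_fps 1" and "Zo = zeta_fps 4 - zeta_fps 1"
  let ?K = "\<lambda>c. {k. int k \<le> (int d - int c - 1) div 2}"
  have K: "?K c = {k. 2 * k + 1 \<le> d - c}" if "c \<le> d" for c
    using that by auto
  have finK: "finite (?K c)" if "c \<le> d" for c
    unfolding K[OF that] by (rule finite_subset[of _ "{..d}"]) auto
  have first: "(bessel_sin d + (1 - 2 * Ze) * bessel_cos d) $ n =
      (\<Sum>j=0..(d - 1) div 2. - 2 * (bessel_cos d $ j * Ze $ (n - j)))"
  proof -
    have "bessel_sin d + (1 - 2 * Ze) * bessel_cos d =
        bessel_sin d + bessel_cos d - fps_const 2 * (bessel_cos d * Ze)"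
      by (simp add: algebra_simps numeral_fps_const)
    then have "(bessel_sin d + (1 - 2 * Ze) * bessel_cos d) $ n =
        bessel_sin d $ n + bessel_cos d $ n - 2 * (bessel_cos d * Ze) $ n"
      by simp
    also have "bessel_sin d $ n = 0" using d by (intro bessel_sin_nth_eq_0) simp
    also have "bessel_cos d $ n = 0" using d by (intro bessel_cos_nth_eq_0) simp
    also have "(bessel_cos d * Ze) $ n = (\<Sum>j=0..(d - 1) div 2. bessel_cos d $ j * Ze $ (n - j))"
      using d by (intro fps_mult_nth_left_support bessel_cos_nth_eq_0) auto
    finally show ?thesis by (simp add: sum_distrib_left flip: sum_negf)
  qed
  have second: "(2 * Zo * bessel_sin (c - 1) * bessel_sin (d - c)
          + fps_X * (bessel_sin (c - 1) * bessel_cos (d - c) + bessel_cos (c - 1) * bessel_sin (d - c))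
          + fps_X * (1 - 2 * Ze) * bessel_cos (c - 1) * bessel_cos (d - c)) $ n =
      2 * (\<Sum>j=0..(c - 1) div 2. \<Sum>k=0..(d - c) div 2.
        bessel_sin (c - 1) $ j * bessel_sin (d - c) $ k * Zo $ (n - j - k))
      - 2 * (\<Sum>j=1..c div 2. \<Sum>k\<in>?K c.
        bessel_cos (c - 1) $ (j - 1) * bessel_cos (d - c) $ k * Ze $ (n - j - k))"
    if c: "c \<in> {1..d}" for c
  proof -
    let ?u = "bessel_sin (c - 1)" and ?v = "bessel_cos (c - 1)"
    let ?u' = "bessel_sin (d - c)" and ?v' = "bessel_cos (d - c)"
    \<comment> \<open>The factor \<open>t\<close> of the products with \<open>bessel_cos\<close> lowers the order to \<open>m\<close>.\<close>
    obtain m where m: "n = Suc m" using d by (cases n) auto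
    have "(2 * Zo * ?u * ?u' + fps_X * (?u * ?v' + ?v * ?u') + fps_X * (1 - 2 * Ze) * ?v * ?v') =
        fps_const 2 * (?u * ?u' * Zo) + fps_X * (?u * ?v') + fps_X * (?u' * ?v) + fps_X * (?v * ?v')
          - fps_const 2 * (fps_X * (?v * ?v' * Ze))"
      by (simp add: algebra_simps numeral_fps_const)
    then have "(2 * Zo * ?u * ?u' + fps_X * (?u * ?v' + ?v * ?u') + fps_X * (1 - 2 * Ze) * ?v * ?v') $ n =
        2 * (?u * ?u' * Zo) $ n + (?u * ?v') $ m + (?u' * ?v) $ m + (?v * ?v') $ m - 2 * (?v * ?v' * Ze) $ m"
      by (simp add: m)
    also have "(?u * ?v') $ m = 0"
      by (rule fps_mult_nth_eq_0_support[of "c - 1" _ "d - c"])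
        (use c d m in \<open>auto intro: bessel_sin_nth_eq_0 bessel_cos_nth_eq_0\<close>)
    also have "(?u' * ?v) $ m = 0"
      by (rule fps_mult_nth_eq_0_support[of "d - c" _ "c - 1"])
        (use c d m in \<open>auto intro: bessel_sin_nth_eq_0 bessel_cos_nth_eq_0\<close>)
    also have "(?v * ?v') $ m = 0"
      by (rule fps_mult_nth_eq_0_support[of "c - 1" _ "d - c"])
        (use c d m in \<open>auto intro: bessel_cos_nth_eq_0\<close>)
    also have "(?u * ?u' * Zo) $ n = (\<Sum>j=0..(c - 1) div 2. \<Sum>k=0..(d - c) div 2.
        ?u $ j * ?u' $ k * Zo $ (n - j - k))"
      by (rule fps_mult3_nth_support) (use c d in \<open>auto intro!: bessel_sin_nth_eq_0\<close>)
    also have "(?v * ?v' * Ze) $ m = (\<Sum>j\<in>{j. 2 * j + 2 \<le> c}. \<Sum>k\<in>?K c.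
        ?v $ j * ?v' $ k * Ze $ (m - j - k))"
    proof (rule fps_mult3_nth_support)
      show "finite {j. 2 * j + 2 \<le> c}" by (rule finite_subset[of _ "{..c}"]) auto
    qed (use c d m finK in \<open>auto simp: K intro!: bessel_cos_nth_eq_0\<close>)
    \<comment> \<open>The same factor \<open>t\<close> is absorbed into \<open>j\<close>, which therefore starts at \<open>1\<close>.\<close>
    also have "\<dots> = (\<Sum>j=1..c div 2. \<Sum>k\<in>?K c. ?v $ (j - 1) * ?v' $ k * Ze $ (n - j - k))"
      by (rule sum.reindex_bij_witness[of _ "\<lambda>j. j - 1" Suc]) (auto simp: m)
    finally show ?thesis by simp
  qed
  have "euler_A_fps d $ n = (-1) ^ d * (\<Sum>j=0..(d - 1) div 2. - 2 * (bessel_cos d $ j * Ze $ (n - j))) +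
     (\<Sum>c=1..d. (-1) ^ (d - c) * (- 1 / (2 * real c)) *
      (2 * (\<Sum>j=0..(c - 1) div 2. \<Sum>k=0..(d - c) div 2.
        bessel_sin (c - 1) $ j * bessel_sin (d - c) $ k * Zo $ (n - j - k))
      - 2 * (\<Sum>j=1..c div 2. \<Sum>k\<in>?K c.
        bessel_cos (c - 1) $ (j - 1) * bessel_cos (d - c) $ k * Ze $ (n - j - k))))"
    unfolding euler_A_fps_closed_form unfolding Zo_def[symmetric] unfolding Ze_def[symmetric] fps_add_nth[of "_ * _"]
      fps_sum_nth mult.assoc[of "_ ^ _" "fps_const _"] minus_one_power_mult_nth fps_mult_left_const_nth first
    by (intro arg_cong2[of _ _ _ _ "(+)"] refl sum.cong) (simp only: second)
  also have "\<dots> = (\<Sum>j=0..(d - 1) div 2. (-1) ^ d * (- 2) * (bessel_cos d $ j * Ze $ (n - j))) +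
     (\<Sum>c=1..d. (\<Sum>j=0..(c - 1) div 2. \<Sum>k=0..(d - c) div 2. (-1) ^ (d - c) * (- 1 / real c) *
        (bessel_sin (c - 1) $ j * bessel_sin (d - c) $ k * Zo $ (n - j - k)))
      + (\<Sum>j=1..c div 2. \<Sum>k\<in>?K c. (-1) ^ (d - c) * (1 / real c) *
        (bessel_cos (c - 1) $ (j - 1) * bessel_cos (d - c) $ k * Ze $ (n - j - k))))"
    unfolding sum_distrib_left[symmetric]
    by (intro arg_cong2[of _ _ _ _ "(+)"] refl sum.cong) (simp_all add: field_simps)
  finally show ?thesis unfolding sum.distrib Ze_def Zo_def by (simp only: add.assoc)
qed

lemma powi_four_single:
  "(4::real) powi (int a - int n - int d + 1) = 4 * 4 ^ a / (4 ^ n * 4 ^ d)"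
  by (simp add: power_int_diff power_int_add)

lemma powi_four_pair: "(4::real) powi (int j + int k - int n) = 4 ^ j * 4 ^ k / 4 ^ n"
  by (simp add: power_int_diff power_int_add)

lemma powi_four_pair_shift:
  "(4::real) powi (int j + int k - int n - int d + 1) = 4 * (4 ^ j * 4 ^ k) / (4 ^ n * 4 ^ d)"
  by (simp add: power_int_diff power_int_add)

lemma four_power_eq: "(2 :: real) ^ (2 * k) = 4 ^ k"
  by (simp add: power_mult)

lemma pi_power_split: "(pi\<^sup>2 / 4) ^ (m + r) = pi ^ (2 * m) * pi ^ (2 * r) / 4 ^ (m + r)"
  by (simp add: power_divide power_mult power_add)

text \<open>
  This lemma and the two after it undo the normalisation by \<open>(4 / \<pi>\<^sup>2)\<^sup>n\<close> in a single summand: the powers of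
  \<open>\<pi>\<close> in the zeta series leave \<open>\<pi>\<^sup>2\<^sup>j\<close> or \<open>\<pi>\<^sup>2\<^sup>j\<^sup>+\<^sup>2\<^sup>k\<close>.
\<close>

lemma rescale_cot_term:
  assumes "2 * j + 1 \<le> d" "d \<le> n"
  shows "(pi\<^sup>2 / 4) ^ n * ((-1) ^ d * (- 2) * (bessel_cos d $ j * zeta_fps 1 $ (n - j))) =
    (-1) ^ j * 4 powi (int j - int n - int d + 1) / fact (2 * j + 1)
         * real ((2 * d - 2 * j - 1) choose d) * zeta (2 * n - 2 * j) * pi ^ (2 * j)"
proof -
  define r where "r = n - j"
  have r: "n = j + r" "r > 0" "2 * n - 2 * j = 2 * r" using assms by (auto simp: r_def)
  define C where "C = real ((2 * d - 2 * j - 1) choose d)"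
  define F :: real where "F = fact (2 * j + 1)"
  define z where "z = zeta (2 * r)"
  have V: "bessel_cos d $ j = (-1) ^ (d + j + 1) * C * (2 * 4 ^ j) / (4 ^ d * F)"
    using assms by (simp add: bessel_cos_def C_def F_def four_power_eq del: fact_Suc)
  have Z: "zeta_fps 1 $ (n - j) = z / pi ^ (2 * r)"
    using r by (simp add: zeta_fps_def z_def)
  have s: "(-1) ^ d * (-1) ^ (d + j + 1) = - ((-1 :: real) ^ j)"
    using minus_one_sign_cancel[of d "j + 1" 1] by (simp add: add.assoc)
  have "(pi\<^sup>2 / 4) ^ n * ((-1) ^ d * (- 2) * (bessel_cos d $ j * zeta_fps 1 $ (n - j))) =
     ((-1) ^ d * (-1) ^ (d + j + 1)) * (- 2) * (pi\<^sup>2 / 4) ^ n * (C * (2 * 4 ^ j) / (4 ^ d * F)) * (z / pi ^ (2 * r))"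
    unfolding V Z by simp
  also have "\<dots> = (-1) ^ j * (4 * 4 ^ j / (4 ^ n * 4 ^ d)) / F * C * z * pi ^ (2 * j)"
    unfolding s unfolding r(1) pi_power_split by (simp add: mult_ac)
  finally show ?thesis unfolding powi_four_single r(3) C_def F_def z_def .
qed

lemma rescale_tan_pair_term:
  assumes "c \<in> {1..d}" "2 * j \<le> c - 1" "2 * k \<le> d - c" "d \<le> n"
  shows "(pi\<^sup>2 / 4) ^ n * ((-1) ^ (d - c) * (- 1 / real c) *
        (bessel_sin (c - 1) $ j * bessel_sin (d - c) $ k * (zeta_fps 4 - zeta_fps 1) $ (n - j - k))) =
       (-1) ^ (c + j + k) * (1 - 4 powi (int j + int k - int n))
         / (real c * fact (2 * j) * fact (2 * k) * 4 ^ (d - 1))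
         * real ((2 * c - 2 * j - 2) choose (c - 1))
         * real ((2 * d - 2 * c - 2 * k) choose (d - c))
         * (zeta (2 * n - 2 * j - 2 * k) * pi ^ (2 * j + 2 * k))"
proof -
  define b e r where "b = c - 1" and "e = d - c" and "r = n - (j + k)"
  have b: "c = Suc b" and e: "d - 1 = b + e" and r: "n = j + k + r" "r > 0" "n - j - k = r"
    "2 * n - 2 * j - 2 * k = 2 * r"
    using assms by (auto simp: b_def e_def r_def)
  define C where "C = real ((2 * c - 2 * j - 2) choose (c - 1))"
  define D where "D = real ((2 * d - 2 * c - 2 * k) choose (d - c))"
  define F G :: real where "F = fact (2 * j)" and "G = fact (2 * k)"
  define z where "z = zeta (2 * r)"
  have U: "bessel_sin (c - 1) $ j = (-1) ^ (b + j) * C * 4 ^ j / (4 ^ b * F)"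
    using assms by (simp add: bessel_sin_def C_def F_def b_def four_power_eq diff_mult_distrib2)
  have U': "bessel_sin (d - c) $ k = (-1) ^ (e + k) * D * 4 ^ k / (4 ^ e * G)"
    using assms by (simp add: bessel_sin_def D_def G_def e_def four_power_eq diff_mult_distrib2)
  have Z: "(zeta_fps 4 - zeta_fps 1) $ (n - j - k) = (4 ^ r - 1) * z / pi ^ (2 * r)"
    unfolding r(3) using r(2) by (simp add: zeta_fps_def z_def left_diff_distrib diff_divide_distrib)
  have s: "(-1) ^ e * ((-1) ^ (b + j) * (-1) ^ (e + k)) = - ((-1 :: real) ^ (c + j + k))"
    using minus_one_sign_cancel[of e k "(-1) ^ (b + j)"] by (simp add: b power_add mult_ac)
  have "(pi\<^sup>2 / 4) ^ n * ((-1) ^ (d - c) * (- 1 / real c) *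
        (bessel_sin (c - 1) $ j * bessel_sin (d - c) $ k * (zeta_fps 4 - zeta_fps 1) $ (n - j - k))) =
     ((-1) ^ e * ((-1) ^ (b + j) * (-1) ^ (e + k))) * (- 1 / real c) * (pi\<^sup>2 / 4) ^ n *
      (C * 4 ^ j / (4 ^ b * F)) * (D * 4 ^ k / (4 ^ e * G)) * ((4 ^ r - 1) * z / pi ^ (2 * r))"
    unfolding U U' Z unfolding e_def[symmetric] by (simp add: mult_ac)
  also have "\<dots> = (-1) ^ (c + j + k) * (4 ^ j * 4 ^ k * (4 ^ r - 1) / 4 ^ n)
       / (real c * F * G * (4 ^ b * 4 ^ e)) * C * D * (z * pi ^ (2 * (j + k)))"
    unfolding s unfolding r(1) pi_power_split by (simp add: mult_ac)
  also have "4 ^ j * 4 ^ k * (4 ^ r - 1) / 4 ^ n = (1 - 4 ^ j * 4 ^ k / 4 ^ n :: real)"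
    unfolding r(1) by (simp add: power_add field_simps)
  finally show ?thesis
    unfolding powi_four_pair r(4) C_def D_def F_def G_def z_def e power_add distrib_left .
qed

lemma rescale_cot_pair_term:
  assumes "c \<in> {1..d}" "1 \<le> j" "2 * j \<le> c" "2 * k + 1 \<le> d - c" "d \<le> n"
  shows "(pi\<^sup>2 / 4) ^ n * ((-1) ^ (d - c) * (1 / real c) *
        (bessel_cos (c - 1) $ (j - 1) * bessel_cos (d - c) $ k * zeta_fps 1 $ (n - j - k))) =
       (-1) ^ (c + j + k) * 4 powi (int j + int k - int n - int d + 1)
         / (real c * fact (2 * j - 1) * fact (2 * k + 1))
         * real ((2 * c - 2 * j - 1) choose (c - 1))
         * real ((2 * d - 2 * c - 2 * k - 1) choose (d - c))
         * (zeta (2 * n - 2 * j - 2 * k) * pi ^ (2 * j + 2 * k))"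
proof -
  define b i e r where "b = c - 1" and "i = j - 1" and "e = d - c" and "r = n - (j + k)"
  have b: "c = Suc b" and i: "j = Suc i" and e: "d = Suc (b + e)" and r: "n = j + k + r" "r > 0"
    "n - j - k = r" "2 * n - 2 * j - 2 * k = 2 * r"
    using assms by (auto simp: b_def i_def e_def r_def)
  define C where "C = real ((2 * c - 2 * j - 1) choose (c - 1))"
  define D where "D = real ((2 * d - 2 * c - 2 * k - 1) choose (d - c))"
  define F G :: real where "F = fact (2 * j - 1)" and "G = fact (2 * k + 1)"
  define z where "z = zeta (2 * r)"
  have V: "bessel_cos (c - 1) $ (j - 1) = (-1) ^ (b + i + 1) * C * (2 * 4 ^ i) / (4 ^ b * F)"
    using assms by (simp add: bessel_cos_def C_def F_def b i four_power_eq del: fact_Suc)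
  have V': "bessel_cos (d - c) $ k = (-1) ^ (e + k + 1) * D * (2 * 4 ^ k) / (4 ^ e * G)"
    using assms by (simp add: bessel_cos_def D_def G_def e_def four_power_eq diff_mult_distrib2 del: fact_Suc)
  have Z: "zeta_fps 1 $ (n - j - k) = z / pi ^ (2 * r)"
    unfolding r(3) using r(2) by (simp add: zeta_fps_def z_def)
  have s: "(-1) ^ e * ((-1) ^ (b + i + 1) * (-1) ^ (e + k + 1)) = ((-1 :: real) ^ (c + j + k))"
    using minus_one_sign_cancel[of e "k + 1" "(-1) ^ (b + i + 1)"] by (simp add: b i power_add mult_ac)
  have "(pi\<^sup>2 / 4) ^ n * ((-1) ^ (d - c) * (1 / real c) *
        (bessel_cos (c - 1) $ (j - 1) * bessel_cos (d - c) $ k * zeta_fps 1 $ (n - j - k))) =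
     ((-1) ^ e * ((-1) ^ (b + i + 1) * (-1) ^ (e + k + 1))) * (1 / real c) * (pi\<^sup>2 / 4) ^ n *
      (C * (2 * 4 ^ i) / (4 ^ b * F)) * (D * (2 * 4 ^ k) / (4 ^ e * G)) * (z / pi ^ (2 * r))"
    unfolding V V' Z unfolding e_def[symmetric] by (simp add: mult_ac)
  also have "\<dots> = (-1) ^ (c + j + k) * (4 * (4 ^ j * 4 ^ k) / (4 ^ n * (4 * (4 ^ b * 4 ^ e))))
         / (real c * F * G) * C * D * (z * pi ^ (2 * (j + k)))"
    unfolding s unfolding r(1) pi_power_split by (simp add: i mult_ac)
  also have "4 * (4 ^ b * 4 ^ e) = (4 :: real) ^ d" by (simp add: e power_add)
  finally show ?thesis unfolding powi_four_pair_shift r(4) C_def D_def F_def G_def z_def distrib_left .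
qed

theorem theorem8p2:
  fixes d n :: nat
  assumes "1 \<le> d" and "d \<le> n"
  shows "euler_A d (2 * n) d =
    (\<Sum>j = 0..(d - 1) div 2.
       (-1) ^ j * 4 powi (int j - int n - int d + 1) / fact (2 * j + 1)
         * real ((2 * d - 2 * j - 1) choose d) * zeta (2 * n - 2 * j) * pi ^ (2 * j))
  + (\<Sum>c = 1..d. \<Sum>j = 0..(c - 1) div 2. \<Sum>k = 0..(d - c) div 2.
       (-1) ^ (c + j + k) * (1 - 4 powi (int j + int k - int n))
         / (real c * fact (2 * j) * fact (2 * k) * 4 ^ (d - 1))
         * real ((2 * c - 2 * j - 2) choose (c - 1))
         * real ((2 * d - 2 * c - 2 * k) choose (d - c))
         * (zeta (2 * n - 2 * j - 2 * k) * pi ^ (2 * j + 2 * k)))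
  + (\<Sum>c = 1..d. \<Sum>j = 1..c div 2. \<Sum>k | int k \<le> (int d - int c - 1) div 2.
       (-1) ^ (c + j + k) * 4 powi (int j + int k - int n - int d + 1)
         / (real c * fact (2 * j - 1) * fact (2 * k + 1))
         * real ((2 * c - 2 * j - 1) choose (c - 1))
         * real ((2 * d - 2 * c - 2 * k - 1) choose (d - c))
         * (zeta (2 * n - 2 * j - 2 * k) * pi ^ (2 * j + 2 * k)))"
proof -
  have start: "euler_A d (2 * n) d = (pi\<^sup>2 / 4) ^ n * euler_A_fps d $ n"
    by (simp add: euler_A_fps_def power_divide)
  show ?thesis
    unfolding start
      euler_A_fps_nth[OF assms] distrib_left sum_distrib_left
  proof (intro arg_cong2[of _ _ _ _ "(+)"] sum.cong refl)
    fix j assume "j \<in> {0..(d - 1) div 2}"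
    then show "(pi\<^sup>2 / 4) ^ n * ((-1) ^ d * (- 2) * (bessel_cos d $ j * zeta_fps 1 $ (n - j))) =
      (-1) ^ j * 4 powi (int j - int n - int d + 1) / fact (2 * j + 1)
         * real ((2 * d - 2 * j - 1) choose d) * zeta (2 * n - 2 * j) * pi ^ (2 * j)"
      using assms by (intro rescale_cot_term) auto
  next
    fix c j k assume "c \<in> {1..d}" "j \<in> {0..(c - 1) div 2}" "k \<in> {0..(d - c) div 2}"
    then show "(pi\<^sup>2 / 4) ^ n * ((-1) ^ (d - c) * (- 1 / real c) *
        (bessel_sin (c - 1) $ j * bessel_sin (d - c) $ k * (zeta_fps 4 - zeta_fps 1) $ (n - j - k))) =
       (-1) ^ (c + j + k) * (1 - 4 powi (int j + int k - int n))
         / (real c * fact (2 * j) * fact (2 * k) * 4 ^ (d - 1))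
         * real ((2 * c - 2 * j - 2) choose (c - 1))
         * real ((2 * d - 2 * c - 2 * k) choose (d - c))
         * (zeta (2 * n - 2 * j - 2 * k) * pi ^ (2 * j + 2 * k))"
      using assms by (intro rescale_tan_pair_term) auto
  next
    fix c j k assume c: "c \<in> {1..d}" "j \<in> {1..c div 2}"
      and k: "k \<in> {k. int k \<le> (int d - int c - 1) div 2}"
    have "2 * int k \<le> int d - int c - 1" using k by auto
    then show "(pi\<^sup>2 / 4) ^ n * ((-1) ^ (d - c) * (1 / real c) *
        (bessel_cos (c - 1) $ (j - 1) * bessel_cos (d - c) $ k * zeta_fps 1 $ (n - j - k))) =
       (-1) ^ (c + j + k) * 4 powi (int j + int k - int n - int d + 1)
         / (real c * fact (2 * j - 1) * fact (2 * k + 1))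
         * real ((2 * c - 2 * j - 1) choose (c - 1))
         * real ((2 * d - 2 * c - 2 * k - 1) choose (d - c))
         * (zeta (2 * n - 2 * j - 2 * k) * pi ^ (2 * j + 2 * k))"
      using assms c by (intro rescale_cot_pair_term) auto
  qed
qed

end
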